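(* Let $n\ge3$. The extended Walsh series of matched $n$-cycles is given, for $n$ odd, by $$W_{C_n}^{\mathrm m}(\mathbf a;\mathbf b;\mathbf c;\beta;\gamma)=\frac{1}{2n}\sum_{d\mid n}\phi\!\left(\tfrac nd\right)a_{n/d}^{\,d}\,T_d(b_{n/d},\beta_{n/d})+\frac12\,a_1a_2^{\frac{n-1}{2}}\Big(\beta_2\gamma_1U_{\frac{n-1}{2}}(b_2,\beta_2)+\beta_2^2c_1U_{\frac{n-3}{2}}(b_2,\beta_2)\Big),$$ and, for $n$ even, by $$W_{C_n}^{\mathrm m}(\mathbf a;\mathbf b;\mathbf c;\beta;\gamma)=\frac{1}{2n}\sum_{d\mid n}\phi\!\left(\tfrac nd\right)a_{n/d}^{\,d}\,T_d(b_{n/d},\beta_{n/d})+\frac14\Big[a_1^2a_2^{\frac{n-2}{2}}\beta_2^2U_{\frac{n-2}{2}}(b_2,\beta_2)$$ $$+\,a_2^{\frac n2}\Big(\gamma_1^2U_{\frac n2}(b_2,\beta_2)+2c_1\gamma_1\beta_2U_{\frac{n-2}{2}}(b_2,\beta_2)+c_1^2\beta_2^2U_{\frac{n-4}{2}}(b_2,\beta_2)\Big)\Big],$$ where $\phi$ is the Euler $\phi$-function.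
   Context: A matching $\mu$ of a finite simple graph $G$ is a set of pairwise disjoint edges of $G$. The homogeneous matching polynomial of $G$ is $M_G(y,z)=\sum_{\mu}y^{|\mu|}z^{m-|\mu|}$, where $\mu$ runs over all matchings of $G$ and $m=|E(G)|$. $P_n$ and $C_n$ denote the path and cycle graphs on $\{1,\ldots,n\}$. Put $U_n(y,z)=M_{P_n}(y,z)$ for $n\ge1$ (so $U_1=1$, $U_2=y+z$), with the convention $U_0(y,z)=1/z$; and $T_n(y,z)=M_{C_n}(y,z)$ for $n\ge3$, with $T_1(y,z)=z$ and $T_2(y,z)=2yz+z^2$. (They satisfy $U_n=yzU_{n-2}+zU_{n-1}$ and $T_n=yz^2U_{n-2}+zU_n$ for $n\ge2$.) Given a graph $G$ with a matching $\mu$, edges in $\mu$ are said to be of sort $Y$ and edges not in $\mu$ of sort $Z$. An automorphism $\sigma$ of $G$ induces a permutation of $E(G)$; a cycle of length $l$ of this permutation is cylindrical if $\sigma^l$ fixes both endpoints of each edge of the cycle, and Möbius if $\sigma^l$ exchanges the two endpoints of each edge of the cycle. Let $\sigma_k$ be the number of vertex cycles of length $k$ of $\sigma$. Let $\mathrm{Fix}^{\mathrm m}(\sigma)$ be the set of matchings $\mu$ of $G$ with $\sigma(\mu)=\mu$. For $\mu\in\mathrm{Fix}^{\mathrm m}(\sigma)$ let $\mathrm{cyl}_{k,Y},\mathrm{m\ddot ob}_{k,Y},\mathrm{cyl}_{k,Z},\mathrm{m\ddot ob}_{k,Z}$ be the numbers of cylindrical and Möbius edge cycles of $\sigma$ of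 length $k$ and of sort $Y$ or $Z$ respectively, and put $$w^\mu(\sigma)=\prod_k a_k^{\sigma_k}b_k^{\mathrm{cyl}_{k,Y}}c_k^{\mathrm{m\ddot ob}_{k,Y}}\beta_k^{\mathrm{cyl}_{k,Z}}\gamma_k^{\mathrm{m\ddot ob}_{k,Z}}.$$ The extended Walsh series of $C_n$ is $$W^{\mathrm m}_{C_n}(\mathbf a;\mathbf b;\mathbf c;\beta;\gamma)=\frac1{|\mathrm{Aut}(C_n)|}\sum_{\sigma\in\mathrm{Aut}(C_n)}\ \sum_{\mu\in\mathrm{Fix}^{\mathrm m}(\sigma)}w^\mu(\sigma),$$ in variables $\mathbf a=(a_k)_{k\ge 1}$, $\mathbf b=(b_k)$, $\mathbf c=(c_k)$, $\beta=(\beta_k)$, $\gamma=(\gamma_k)$. *)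

theory Defs
  imports
    Complex_Main
    "HOL-Library.Disjoint_Sets"
    "HOL-Combinatorics.Permutations"
    "HOL-Combinatorics.Orbits"
    "HOL-Number_Theory.Totient"
begin

section \<open>Finite simple graphs\<close>

type_synonym 'a graph = "'a set \<times> 'a set set"

abbreviation verts :: "'a graph \<Rightarrow> 'a set" where "verts \<equiv> fst"
abbreviation edges :: "'a graph \<Rightarrow> 'a set set" where "edges \<equiv> snd"

definition finite_simple_graph :: "'a graph \<Rightarrow> bool" where
  "finite_simple_graph G \<longleftrightarrow> finite (verts G) \<and> (\<forall>e\<in>edges G. e \<subseteq> verts G \<and> card e = 2)"

definition path_graph :: "nat \<Rightarrow> nat graph" where
  "path_graph n = ({1..n}, {{i, i + 1} | i. 1 \<le> i \<and> i < n})"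

text \<open>This is the cycle graph only for \<open>n \<ge> 3\<close>.\<close>

definition cycle_graph :: "nat \<Rightarrow> nat graph" where
  "cycle_graph n = ({1..n}, {{i, i + 1} | i. 1 \<le> i \<and> i < n} \<union> {{n, 1}})"

lemma finite_simple_path_graph: "finite_simple_graph (path_graph n)"
  by (auto simp: finite_simple_graph_def path_graph_def)

lemma finite_simple_cycle_graph: "n \<ge> 3 \<Longrightarrow> finite_simple_graph (cycle_graph n)"
  by (auto simp: finite_simple_graph_def cycle_graph_def)


section \<open>Matchings and the homogeneous matching polynomial\<close>

definition matchings :: "'a graph \<Rightarrow> 'a set set set" where
  "matchings G = {\<mu>. \<mu> \<subseteq> edges G \<and> disjoint \<mu>}"

definition matching_poly :: "'a graph \<Rightarrow> 'b \<Rightarrow> 'b \<Rightarrow> 'b::comm_semiring_1" where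
  "matching_poly G y z = (\<Sum>\<mu>\<in>matchings G. y ^ card \<mu> * z ^ (card (edges G) - card \<mu>))"

definition path_U :: "nat \<Rightarrow> 'b \<Rightarrow> 'b \<Rightarrow> 'b::field" where
  "path_U n y z = (if n = 0 then 1 / z else matching_poly (path_graph n) y z)"

text \<open>Only indices \<open>n \<ge> 1\<close> are meaningful; the value at \<open>0\<close> is arbitrary.\<close>

definition cycle_T :: "nat \<Rightarrow> 'b \<Rightarrow> 'b \<Rightarrow> 'b::field" where
  "cycle_T n y z =
    (if n = 1 then z else if n = 2 then 2 * y * z + z ^ 2 else matching_poly (cycle_graph n) y z)"


section \<open>Automorphisms and their cycles\<close>

text \<open>Automorphisms are extended by the identity outside the vertex set, so that each of them
  is represented by exactly one function.\<close>

definition automorphisms :: "'a graph \<Rightarrow> ('a \<Rightarrow> 'a) set" where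
  "automorphisms G = {\<sigma>. \<sigma> permutes verts G \<and>
     (\<forall>u\<in>verts G. \<forall>v\<in>verts G. {u, v} \<in> edges G \<longleftrightarrow> {\<sigma> u, \<sigma> v} \<in> edges G)}"

text \<open>A cycle of a permutation is represented by its set of elements; fixed points are cycles of
  length 1. The permutation of the edges induced by \<open>\<sigma>\<close> is \<open>(`) \<sigma>\<close>.\<close>

definition vertex_cycles :: "'a graph \<Rightarrow> ('a \<Rightarrow> 'a) \<Rightarrow> 'a set set" where
  "vertex_cycles G \<sigma> = orbit \<sigma> ` verts G"

definition edge_cycles :: "'a graph \<Rightarrow> ('a \<Rightarrow> 'a) \<Rightarrow> 'a set set set" where
  "edge_cycles G \<sigma> = orbit ((`) \<sigma>) ` edges G"

definition cylindrical :: "('a \<Rightarrow> 'a) \<Rightarrow> 'a set set \<Rightarrow> bool" where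
  "cylindrical \<sigma> C \<longleftrightarrow> (\<forall>e\<in>C. \<forall>v\<in>e. (\<sigma> ^^ card C) v = v)"

definition moebius :: "('a \<Rightarrow> 'a) \<Rightarrow> 'a set set \<Rightarrow> bool" where
  "moebius \<sigma> C \<longleftrightarrow> (\<forall>e\<in>C. \<forall>u\<in>e. \<forall>v\<in>e. u \<noteq> v \<longrightarrow> (\<sigma> ^^ card C) u = v)"


section \<open>The extended Walsh series\<close>

definition fixed_matchings :: "'a graph \<Rightarrow> ('a \<Rightarrow> 'a) \<Rightarrow> 'a set set set" where
  "fixed_matchings G \<sigma> = {\<mu> \<in> matchings G. (`) \<sigma> ` \<mu> = \<mu>}"

definition vcyc :: "'a graph \<Rightarrow> ('a \<Rightarrow> 'a) \<Rightarrow> nat \<Rightarrow> nat" where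
  "vcyc G \<sigma> k = card {C \<in> vertex_cycles G \<sigma>. card C = k}"

text \<open>For a matching fixed by \<open>\<sigma>\<close>, every edge cycle is either contained in the matching
  (sort Y) or disjoint from it (sort Z).\<close>

definition cyl_Y :: "'a graph \<Rightarrow> ('a \<Rightarrow> 'a) \<Rightarrow> 'a set set \<Rightarrow> nat \<Rightarrow> nat" where
  "cyl_Y G \<sigma> \<mu> k = card {C \<in> edge_cycles G \<sigma>. card C = k \<and> cylindrical \<sigma> C \<and> C \<subseteq> \<mu>}"

definition moeb_Y :: "'a graph \<Rightarrow> ('a \<Rightarrow> 'a) \<Rightarrow> 'a set set \<Rightarrow> nat \<Rightarrow> nat" where
  "moeb_Y G \<sigma> \<mu> k = card {C \<in> edge_cycles G \<sigma>. card C = k \<and> moebius \<sigma> C \<and> C \<subseteq> \<mu>}"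

definition cyl_Z :: "'a graph \<Rightarrow> ('a \<Rightarrow> 'a) \<Rightarrow> 'a set set \<Rightarrow> nat \<Rightarrow> nat" where
  "cyl_Z G \<sigma> \<mu> k = card {C \<in> edge_cycles G \<sigma>. card C = k \<and> cylindrical \<sigma> C \<and> C \<inter> \<mu> = {}}"

definition moeb_Z :: "'a graph \<Rightarrow> ('a \<Rightarrow> 'a) \<Rightarrow> 'a set set \<Rightarrow> nat \<Rightarrow> nat" where
  "moeb_Z G \<sigma> \<mu> k = card {C \<in> edge_cycles G \<sigma>. card C = k \<and> moebius \<sigma> C \<and> C \<inter> \<mu> = {}}"

text \<open>A cycle is never longer than the number of vertices resp. edges, so all exponents vanish for
  larger \<open>k\<close>, and the bound below only omits factors equal to 1.\<close>

definition walsh_weight ::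
  "'a graph \<Rightarrow> (nat \<Rightarrow> 'b) \<Rightarrow> (nat \<Rightarrow> 'b) \<Rightarrow> (nat \<Rightarrow> 'b) \<Rightarrow> (nat \<Rightarrow> 'b) \<Rightarrow> (nat \<Rightarrow> 'b) \<Rightarrow>
    ('a \<Rightarrow> 'a) \<Rightarrow> 'a set set \<Rightarrow> 'b::comm_semiring_1" where
  "walsh_weight G a b c \<beta> \<gamma> \<sigma> \<mu> =
    (\<Prod>k = 1..max (card (verts G)) (card (edges G)).
       a k ^ vcyc G \<sigma> k * b k ^ cyl_Y G \<sigma> \<mu> k * c k ^ moeb_Y G \<sigma> \<mu> k *
       \<beta> k ^ cyl_Z G \<sigma> \<mu> k * \<gamma> k ^ moeb_Z G \<sigma> \<mu> k)"

text \<open>The indeterminates are given by their values in a field of characteristic 0; the generic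
  case is that of algebraically independent values in a field of rational functions.\<close>

definition walsh_series ::
  "'a graph \<Rightarrow> (nat \<Rightarrow> 'b) \<Rightarrow> (nat \<Rightarrow> 'b) \<Rightarrow> (nat \<Rightarrow> 'b) \<Rightarrow> (nat \<Rightarrow> 'b) \<Rightarrow> (nat \<Rightarrow> 'b) \<Rightarrow>
    'b::field_char_0" where
  "walsh_series G a b c \<beta> \<gamma> =
    1 / of_nat (card (automorphisms G)) *
    (\<Sum>\<sigma>\<in>automorphisms G. \<Sum>\<mu>\<in>fixed_matchings G \<sigma>. walsh_weight G a b c \<beta> \<gamma> \<sigma> \<mu>)"

end

theory Submission
  imports Defs
begin

text \<open>
  Number the vertices and edges of the cycle by the integers modulo \<open>n\<close>, edge \<open>i\<close> joining \<open>i\<close> to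
  \<open>i + 1\<close>. The automorphisms are the rotations \<open>i \<mapsto> i + r\<close> and the reflections \<open>i \<mapsto> s - i\<close>. A
  matching fixed by \<open>\<sigma>\<close> is a set of edge cycles of \<open>\<sigma>\<close> that never contains both the cycle of an edge
  \<open>i\<close> and the cycle of \<open>i + 1\<close>, and its weight is a product over all edge cycles. For a rotation
  with \<open>gcd r n = d\<close> the edge cycles are the residues modulo \<open>d\<close>, all cylindrical of length
  \<open>n / d\<close>, which gives \<open>T\<^sub>d\<close>. For a reflection the edge cycles form a path; one at an
  end of it is either a fixed edge (Moebius) or a pair of edges sharing a fixed vertex, and the
  latter is in no fixed matching. Deleting the ends of the path gives the terms in \<open>U\<close>.
\<close>

section \<open>Sparse sums and matchings of paths\<close>

text \<open>The variables are arbitrary field elements, so \<open>\<beta> 2 = 0\<close> is allowed,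
  and then \<open>path_U 0\<close> is \<open>1 / 0 = 0\<close>. The identities involving
  \<open>path_U 0\<close> rest on \<open>z ^ 2 * (1 / z) = z\<close>, which holds even at
  \<open>0\<close>, and not on \<open>z * (1 / z) = 1\<close>, which does not. This is why a factor
  \<open>\<beta> 2 ^ 2\<close> has to accompany \<open>path_U 0\<close>, which occurs for
  \<open>n = 3\<close> and \<open>n = 4\<close>. The condition on \<open>S\<close> runs over all
  integers \<open>i\<close>, so that one definition covers cycles, paths and degenerate quotients:
  if \<open>\<rho> i = \<rho> (i + 1)\<close>, that class is adjacent to itself and can never be
  selected. There are \<open>n\<close> reflections, but moving the origin of the labelling reduces
  them to two, \<open>1 - i\<close> and \<open>- i\<close> on vertices. The induced constant on
  edges is smaller by one. Up to a shift of labels, the two foldings \<open>reflect_rep n 0\<close>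
  and \<open>reflect_rep n (- 1)\<close> therefore suffice for vertices and edges alike, with their
  roles exchanged between the two types of reflection.\<close>

text \<open>Here \<open>\<rho>\<close> sends the index of an edge to the representative of its cycle.\<close>

definition sparse_sum ::
  "(int \<Rightarrow> int) \<Rightarrow> int set \<Rightarrow> (int \<Rightarrow> 'b) \<Rightarrow> (int \<Rightarrow> 'b) \<Rightarrow> 'b::comm_semiring_1" where
  "sparse_sum \<rho> J y z =
    (\<Sum>S | S \<subseteq> J \<and> (\<forall>i. \<rho> i \<in> S \<longrightarrow> \<rho> (i + 1) \<notin> S). \<Prod>j\<in>J. if j \<in> S then y j else z j)"

lemma sparse_sum_cong:
  assumes "J = J'" "\<And>j. j \<in> J' \<Longrightarrow> y j = y' j" "\<And>j. j \<in> J' \<Longrightarrow> z j = z' j"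
  shows "sparse_sum \<rho> J y z = sparse_sum \<rho> J' y' z'"
  unfolding sparse_sum_def assms(1)
  by (intro sum.cong prod.cong refl) (use assms(2,3) in auto)

lemma sparse_sum_empty [simp]: "sparse_sum \<rho> {} y z = 1"
proof -
  have "{S. S \<subseteq> {} \<and> (\<forall>i. \<rho> i \<in> S \<longrightarrow> \<rho> (i + 1) \<notin> S)} = {{}}" by auto
  then show ?thesis by (simp add: sparse_sum_def)
qed

lemma prod_if_mem:
  assumes "finite J" "S \<subseteq> J"
  shows "(\<Prod>j\<in>J. if j \<in> S then y else z) = y ^ card S * (z::'b::comm_semiring_1) ^ (card J - card S)"
proof -
  have fS: "finite S" using assms finite_subset by blast
  have "(\<Prod>j\<in>J. if j \<in> S then y else z) = (\<Prod>j\<in>J \<inter> {j. j \<in> S}. y) * (\<Prod>j\<in>J \<inter> - {j. j \<in> S}. z)"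
    using assms(1) by (rule prod.If_cases)
  also have "J \<inter> {j. j \<in> S} = S" using assms(2) by auto
  also have "J \<inter> - {j. j \<in> S} = J - S" by auto
  finally show ?thesis using assms fS by (simp add: card_Diff_subset)
qed

text \<open>A class in \<open>B\<close> is never selected, so it always contributes its
  \<open>z\<close> and can be split off. At the same time \<open>\<rho>\<close> is replaced by the
  simpler \<open>\<rho>'\<close>, in the applications the identity, which turns a folded cycle into
  a path.\<close>

lemma sparse_sum_avoid:
  assumes "finite J" "B \<subseteq> J"
    and "\<And>S. S \<subseteq> J \<Longrightarrow> (\<forall>i. \<rho> i \<in> S \<longrightarrow> \<rho> (i + 1) \<notin> S) \<longleftrightarrow>
      S \<inter> B = {} \<and> (\<forall>i. \<rho>' i \<in> S \<longrightarrow> \<rho>' (i + 1) \<notin> S)"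
  shows "sparse_sum \<rho> J y z = prod z B * sparse_sum \<rho>' (J - B) y z"
proof -
  have sets: "{S. S \<subseteq> J \<and> (\<forall>i. \<rho> i \<in> S \<longrightarrow> \<rho> (i + 1) \<notin> S)} =
      {S. S \<subseteq> J - B \<and> (\<forall>i. \<rho>' i \<in> S \<longrightarrow> \<rho>' (i + 1) \<notin> S)}"
    using assms(3) by blast
  have "(\<Prod>j\<in>J. if j \<in> S then y j else z j) = prod z B * (\<Prod>j\<in>J - B. if j \<in> S then y j else z j)"
    if "S \<subseteq> J - B" for S
  proof -
    have "(\<Prod>j\<in>J. if j \<in> S then y j else z j) =
        (\<Prod>j\<in>J - B. if j \<in> S then y j else z j) * (\<Prod>j\<in>B. if j \<in> S then y j else z j)"
      using assms by (intro prod.subset_diff) auto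
    also have "(\<Prod>j\<in>B. if j \<in> S then y j else z j) = prod z B"
      using that by (intro prod.cong) auto
    finally show ?thesis by (simp add: mult.commute)
  qed
  then show ?thesis unfolding sparse_sum_def sets sum_distrib_left by (intro sum.cong) auto
qed

text \<open>The usual recursion for matchings at one edge \<open>x\<close> of a path: either
  \<open>x\<close> is unmatched, or it is matched and its neighbours \<open>x - 1\<close>,
  \<open>x + 1\<close>, as far as they lie in \<open>J\<close>, are forced to be unmatched.\<close>

lemma sparse_sum_insert:
  assumes "finite J" "x \<notin> J"
  shows "sparse_sum (\<lambda>i. i) (insert x J) y z = z x * sparse_sum (\<lambda>i. i) J y z +
    y x * (prod z (J \<inter> {x - 1, x + 1}) * sparse_sum (\<lambda>i. i) (J - {x - 1, x + 1}) y z)"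
proof -
  let ?sp = "\<lambda>S::int set. \<forall>i. i \<in> S \<longrightarrow> i + 1 \<notin> S"
  let ?w = "\<lambda>J S. \<Prod>j\<in>J. if j \<in> S then y j else z j"
  let ?A = "{S. S \<subseteq> J \<and> ?sp S}"
  let ?N = "J - {x - 1, x + 1}"
  let ?B = "{S. S \<subseteq> ?N \<and> ?sp S}"
  have eq: "{S. S \<subseteq> insert x J \<and> ?sp S} = ?A \<union> insert x ` ?B"
  proof (intro set_eqI iffI)
    fix S assume S: "S \<in> {S. S \<subseteq> insert x J \<and> ?sp S}"
    show "S \<in> ?A \<union> insert x ` ?B"
    proof (cases "x \<in> S")
      case True
      have "x - 1 \<notin> S" using S True by (metis (mono_tags, lifting) diff_add_cancel mem_Collect_eq)
      moreover have "x + 1 \<notin> S" using S True by auto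
      ultimately have "S - {x} \<in> ?B" using S by auto
      then show ?thesis using True by (auto intro!: image_eqI[of _ _ "S - {x}"])
    next
      case False then show ?thesis using S by auto
    qed
  next
    fix S assume "S \<in> ?A \<union> insert x ` ?B"
    then show "S \<in> {S. S \<subseteq> insert x J \<and> ?sp S}" using assms(2) by fastforce
  qed
  have inj: "inj_on (insert x) ?B" by (rule inj_on_inverseI[where g = "\<lambda>S. S - {x}"]) (use assms(2) in auto)
  have "sparse_sum (\<lambda>i. i) (insert x J) y z = (\<Sum>S\<in>?A. ?w (insert x J) S) + (\<Sum>S\<in>insert x ` ?B. ?w (insert x J) S)"
    unfolding sparse_sum_def eq using assms
    by (intro sum.union_disjoint) (auto intro: finite_subset[of _ "Pow J"])
  also have "(\<Sum>S\<in>?A. ?w (insert x J) S) = (\<Sum>S\<in>?A. z x * ?w J S)"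
    using assms by (intro sum.cong) auto
  also have "\<dots> = z x * sparse_sum (\<lambda>i. i) J y z" by (simp add: sparse_sum_def sum_distrib_left)
  also have "(\<Sum>S\<in>insert x ` ?B. ?w (insert x J) S) = (\<Sum>S\<in>?B. ?w (insert x J) (insert x S))"
    by (simp add: sum.reindex[OF inj])
  also have "\<dots> = (\<Sum>S\<in>?B. y x * ?w J S)"
  proof (intro sum.cong refl)
    fix S assume "S \<in> ?B"
    have "?w J (insert x S) = ?w J S" using assms by (intro prod.cong) auto
    then show "?w (insert x J) (insert x S) = y x * ?w J S" using assms by simp
  qed
  also have "\<dots> = (\<Sum>S\<in>?B. y x * (prod z (J \<inter> {x - 1, x + 1}) * ?w ?N S))"
  proof (intro sum.cong refl)
    fix S assume S: "S \<in> ?B"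
    have "?w J S = ?w ?N S * ?w (J \<inter> {x - 1, x + 1}) S"
      using assms by (subst prod.subset_diff[of "J \<inter> {x - 1, x + 1}" J])
        (auto intro!: arg_cong2[of _ _ _ _ "(*)"] prod.cong)
    also have "?w (J \<inter> {x - 1, x + 1}) S = prod z (J \<inter> {x - 1, x + 1})"
      using S by (intro prod.cong) auto
    finally show "y x * ?w J S = y x * (prod z (J \<inter> {x - 1, x + 1}) * ?w ?N S)"
      by (simp add: mult.commute)
  qed
  also have "\<dots> = y x * (prod z (J \<inter> {x - 1, x + 1}) * sparse_sum (\<lambda>i. i) ?N y z)"
    by (simp add: sparse_sum_def sum_distrib_left)
  finally show ?thesis .
qed

lemma disjoint_image_iff:
  "inj_on e S \<Longrightarrow> disjoint (e ` S) \<longleftrightarrow> (\<forall>i\<in>S. \<forall>j\<in>S. i \<noteq> j \<longrightarrow> e i \<inter> e j = {})"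
  by (simp add: disjoint_def) (metis inj_onD)

lemma matching_poly_eq_sparse_sum:
  assumes e: "bij_betw e J (edges G)" and "finite J"
    and adj: "\<And>S. S \<subseteq> J \<Longrightarrow> disjoint (e ` S) \<longleftrightarrow> (\<forall>i. \<rho> i \<in> S \<longrightarrow> \<rho> (i + 1) \<notin> S)"
  shows "matching_poly G y z = sparse_sum \<rho> J (\<lambda>_. y) (\<lambda>_. z)"
proof -
  let ?A = "{S. S \<subseteq> J \<and> (\<forall>i. \<rho> i \<in> S \<longrightarrow> \<rho> (i + 1) \<notin> S)}"
  have inj: "inj_on e J" and im: "e ` J = edges G" using e by (auto simp: bij_betw_def)
  have "matchings G = (`) e ` ?A"
  proof (intro set_eqI iffI)
    fix \<mu> assume \<mu>: "\<mu> \<in> matchings G"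
    then obtain S where "S \<subseteq> J" "\<mu> = e ` S"
      unfolding matchings_def by (smt (verit) im mem_Collect_eq subset_image_iff)
    then show "\<mu> \<in> (`) e ` ?A" using \<mu> adj[of S] by (auto simp: matchings_def)
  next
    fix \<mu> assume "\<mu> \<in> (`) e ` ?A"
    then obtain S where "\<mu> = e ` S" "S \<in> ?A" by blast
    then show "\<mu> \<in> matchings G" using im adj[of S] by (auto simp: matchings_def)
  qed
  moreover have "inj_on ((`) e) ?A"
    using inj by (auto intro!: inj_onI simp: inj_on_image_eq_iff)
  ultimately have "matching_poly G y z = (\<Sum>S\<in>?A. y ^ card (e ` S) * z ^ (card (edges G) - card (e ` S)))"
    by (simp add: matching_poly_def sum.reindex)
  also have "\<dots> = sparse_sum \<rho> J (\<lambda>_. y) (\<lambda>_. z)"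
    unfolding sparse_sum_def
  proof (intro sum.cong refl)
    fix S assume "S \<in> ?A"
    then have "card (e ` S) = card S" "card (edges G) = card J"
      using inj im card_image[of e J] by (auto intro!: card_image inj_on_subset[OF inj])
    then show "y ^ card (e ` S) * z ^ (card (edges G) - card (e ` S)) = (\<Prod>j\<in>J. if j \<in> S then y else z)"
      using \<open>S \<in> ?A\<close> assms(2) by (simp add: prod_if_mem)
  qed
  finally show ?thesis .
qed

text \<open>A path with \<open>m + 1\<close> vertices has \<open>m\<close> edges, hence the
  \<open>Suc\<close>. The left end \<open>l\<close> is free because deleting end edges later leaves
  intervals with various starting points.\<close>

lemma path_U_eq_sparse_sum:
  "path_U (Suc m) y z = sparse_sum (\<lambda>i. i) {l..<l + int m} (\<lambda>_. y) (\<lambda>_. z)"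
proof -
  define e where "e = (\<lambda>i::int. {nat (i - l) + 1, nat (i - l) + 2})"
  have disj: "e i \<inter> e j = {} \<longleftrightarrow> i \<noteq> j \<and> i \<noteq> j + 1 \<and> j \<noteq> i + 1"
    if "i \<in> {l..<l + int m}" "j \<in> {l..<l + int m}" for i j
    using that by (auto simp: e_def)
  have inj: "inj_on e {l..<l + int m}"
    by (rule inj_onI) (auto simp: e_def doubleton_eq_iff)
  have im: "e ` {l..<l + int m} = edges (path_graph (Suc m))"
  proof (intro set_eqI iffI)
    fix x assume "x \<in> edges (path_graph (Suc m))"
    then obtain i where i: "x = {i, i + 1}" "1 \<le> i" "i < Suc m" by (auto simp: path_graph_def)
    have "x = e (l + int i - 1)" using i by (auto simp: e_def nat_diff_distrib)
    then show "x \<in> e ` {l..<l + int m}" using i by auto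
  next
    fix x assume "x \<in> e ` {l..<l + int m}"
    then obtain i where i: "x = e i" "l \<le> i" "i < l + int m" by auto
    have "x = {nat (i - l) + 1, (nat (i - l) + 1) + 1}" "nat (i - l) + 1 < Suc m"
      using i by (auto simp: e_def)
    then show "x \<in> edges (path_graph (Suc m))" unfolding path_graph_def by fastforce
  qed
  have "matching_poly (path_graph (Suc m)) y z = sparse_sum (\<lambda>i. i) {l..<l + int m} (\<lambda>_. y) (\<lambda>_. z)"
  proof (rule matching_poly_eq_sparse_sum[of e])
    show "bij_betw e {l..<l + int m} (edges (path_graph (Suc m)))"
      using inj im by (simp add: bij_betw_def)
    fix S assume S: "S \<subseteq> {l..<l + int m}"
    have "disjoint (e ` S) \<longleftrightarrow> (\<forall>i\<in>S. \<forall>j\<in>S. i \<noteq> j \<longrightarrow> e i \<inter> e j = {})"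
      using inj_on_subset[OF inj S] by (rule disjoint_image_iff)
    also have "\<dots> \<longleftrightarrow> (\<forall>i. i \<in> S \<longrightarrow> i + 1 \<notin> S)"
    proof
      assume *: "\<forall>i\<in>S. \<forall>j\<in>S. i \<noteq> j \<longrightarrow> e i \<inter> e j = {}"
      show "\<forall>i. i \<in> S \<longrightarrow> i + 1 \<notin> S"
      proof (intro allI impI notI)
        fix i assume i: "i \<in> S" "i + 1 \<in> S"
        then have "e i \<inter> e (i + 1) = {}" using * by auto
        then show False using disj subsetD[OF S i(1)] subsetD[OF S i(2)] by simp
      qed
    next
      assume *: "\<forall>i. i \<in> S \<longrightarrow> i + 1 \<notin> S"
      show "\<forall>i\<in>S. \<forall>j\<in>S. i \<noteq> j \<longrightarrow> e i \<inter> e j = {}"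
      proof (intro ballI impI)
        fix i j assume ij: "i \<in> S" "j \<in> S" "i \<noteq> j"
        then have "i \<noteq> j + 1" "j \<noteq> i + 1" using * by auto
        then show "e i \<inter> e j = {}" using disj ij subsetD[OF S ij(1)] subsetD[OF S ij(2)] by simp
      qed
    qed
    finally show "disjoint (e ` S) \<longleftrightarrow> (\<forall>i. i \<in> S \<longrightarrow> i + 1 \<notin> S)" .
  qed simp
  then show ?thesis by (simp add: path_U_def)
qed

section \<open>Orbits of rotations and reflections\<close>

lemma image_residue_classes:
  fixes q :: "int \<Rightarrow> 'b"
  assumes "n > 0" and per: "\<And>i j. int n dvd i - j \<Longrightarrow> q i = q j"
  shows "range q = q ` {0..<int n}"
proof -
  have "q i = q (i mod int n)" for i
    by (rule per) (simp add: minus_mod_eq_mult_div)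
  then show ?thesis using assms(1) by (auto intro!: image_eqI[where x = "_ mod int n"])
qed

lemma card_range_residue_classes:
  assumes "n > 0" and per: "\<And>i j. q i = q j \<longleftrightarrow> int n dvd i - j"
  shows "card (range q) = n"
proof -
  have "inj_on q {0..<int n}"
    by (rule inj_onI) (metis per atLeastLessThan_iff mod_eq_dvd_iff mod_pos_pos_trivial)
  moreover have "range q = q ` {0..<int n}" using assms by (intro image_residue_classes) auto
  ultimately show ?thesis by (simp add: card_image)
qed

text \<open>Walking through the class of \<open>i\<close> in steps of \<open>d\<close> is again a
  periodic labelling, now with period \<open>n div d\<close>.\<close>

lemma card_image_residue_subclass:
  fixes q :: "int \<Rightarrow> 'b"
  assumes "n > 0" "d dvd n" and per: "\<And>i j. q i = q j \<longleftrightarrow> int n dvd i - j"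
  shows "card (q ` {j. int d dvd j - i}) = n div d"
proof -
  obtain m where m: "n = d * m" using assms(2) by blast
  have pos: "d > 0" "m > 0" using m assms(1) by auto
  define q' where "q' = (\<lambda>t. q (i + int d * t))"
  have "q ` {j. int d dvd j - i} = range q'"
  proof -
    have "{j. int d dvd j - i} = range (\<lambda>t. i + int d * t)"
      by (auto simp: dvd_def image_def) (metis add.commute diff_add_cancel)
    then show ?thesis by (auto simp: q'_def)
  qed
  moreover have "card (range q') = m"
  proof (rule card_range_residue_classes[OF pos(2)])
    fix t u
    have "int n dvd (i + int d * t) - (i + int d * u) \<longleftrightarrow> int d * int m dvd int d * (t - u)"
      by (simp add: m algebra_simps)
    then show "q' t = q' u \<longleftrightarrow> int m dvd t - u" using pos by (simp add: q'_def per)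
  qed
  ultimately show ?thesis using m pos by simp
qed

text \<open>By Bezout, the multiples of \<open>r\<close> modulo \<open>n\<close> are exactly the
  multiples of \<open>gcd r n\<close>. Stated for an abstract periodic \<open>q\<close>, it serves
  for vertices and for edges.\<close>

lemma orbit_rotation:
  fixes q :: "int \<Rightarrow> 'b"
  assumes "n > 0" and per: "\<And>i j. q i = q j \<longleftrightarrow> int n dvd i - j"
    and f: "\<And>i. f (q i) = q (i + int r)"
  shows "orbit f (q i) = q ` {j. int (gcd r n) dvd j - i}"
proof -
  have pow: "(f ^^ k) (q i) = q (i + int k * int r)" for k
    by (induction k) (simp_all add: f algebra_simps)
  show ?thesis
  proof (intro set_eqI iffI)
    fix x assume "x \<in> orbit f (q i)"
    then obtain k where "x = q (i + int k * int r)" by (auto simp: orbit_altdef pow)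
    then show "x \<in> q ` {j. int (gcd r n) dvd j - i}"
      by (intro image_eqI[where x = "i + int k * int r"]) auto
  next
    fix x assume "x \<in> q ` {j. int (gcd r n) dvd j - i}"
    then obtain t where x: "x = q (i + int (gcd r n) * t)"
      by (auto simp: dvd_def) (metis add.commute diff_add_cancel)
    obtain u v where uv: "u * int r + v * int n = int (gcd r n)"
      using bezout_int[of "int r" "int n"] by auto
    \<comment> \<open>The Bezout exponent \<open>u * t\<close> may be negative, so it is reduced
      modulo \<open>n\<close>. Adding \<open>n\<close> makes it positive, since an orbit consists of
      the iterates with positive exponent.\<close>
    define k where "k = nat ((u * t) mod int n) + n"
    have "int n dvd int k - u * t"
      using assms(1) by (simp add: k_def mod_eq_dvd_iff[symmetric])
    then have "int n dvd (int k - u * t) * int r - int n * (v * t)"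
      by (intro dvd_diff[OF dvd_mult2 dvd_triv_left])
    also have "(int k - u * t) * int r - int n * (v * t) =
        (i + int k * int r) - (i + int (gcd r n) * t)"
      unfolding uv[symmetric] by (simp add: algebra_simps)
    finally have "(f ^^ k) (q i) = x" by (simp only: x pow per)
    moreover have "k > 0" using assms(1) by (simp add: k_def)
    ultimately show "x \<in> orbit f (q i)" by (auto simp: orbit_altdef)
  qed
qed

text \<open>A canonical representative of the class of \<open>i\<close> and \<open>s - i\<close>
  modulo \<open>n\<close>. Taking the smaller residue makes the representatives an initial interval
  for \<open>s = 0\<close> and \<open>s = - 1\<close>, so the quotient is visibly a path.\<close>

definition reflect_rep :: "nat \<Rightarrow> int \<Rightarrow> int \<Rightarrow> int" where
  "reflect_rep n s i = min (i mod int n) ((s - i) mod int n)"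

lemma reflect_rep_eq_iff:
  "reflect_rep n s i = reflect_rep n s j \<longleftrightarrow> int n dvd i - j \<or> int n dvd i - (s - j)"
proof -
  have swap: "x mod int n = (s - y) mod int n \<longleftrightarrow> (s - x) mod int n = y mod int n" for x y
  proof -
    have "(s - x) - y = - (x - (s - y))" by simp
    then show ?thesis unfolding mod_eq_dvd_iff by (simp only: dvd_minus_iff)
  qed
  have diag: "x mod int n = y mod int n \<Longrightarrow> (s - x) mod int n = (s - y) mod int n" for x y
    by (metis mod_diff_right_eq)
  have diag': "(s - x) mod int n = (s - y) mod int n \<Longrightarrow> x mod int n = y mod int n" for x y
    using diag[of "s - x" "s - y"] by (simp only: diff_diff_eq2 add_diff_cancel_left')
  \<comment> \<open>Equal minima allow four coincidences between the two pairs; because the pairs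
    are orbits of an involution, these collapse to two.\<close>
  have min_eq: "min a a' = min b b' \<longleftrightarrow> a = b \<or> a = b'"
    if "a = b' \<longleftrightarrow> a' = b" "a = b \<Longrightarrow> a' = b'" "a' = b' \<Longrightarrow> a = b" for a a' b b' :: int
    using that by (auto simp: min_def)
  have "reflect_rep n s i = reflect_rep n s j \<longleftrightarrow>
      i mod int n = j mod int n \<or> i mod int n = (s - j) mod int n"
    unfolding reflect_rep_def by (rule min_eq[OF swap diag diag'])
  then show ?thesis by (simp only: mod_eq_dvd_iff)
qed

lemma reflect_rep_idem: "reflect_rep n s (reflect_rep n s i) = reflect_rep n s i"
proof -
  have "reflect_rep n s i = i mod int n \<or> reflect_rep n s i = (s - i) mod int n"
    by (auto simp: reflect_rep_def min_def)
  moreover have "int n dvd x mod int n - x" for x by (simp add: mod_eq_dvd_iff[symmetric])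
  ultimately show ?thesis by (auto simp: reflect_rep_eq_iff)
qed

lemma orbit_reflection:
  fixes q :: "int \<Rightarrow> 'b"
  assumes f: "\<And>i. f (q i) = q (s - i)"
  shows "orbit f (q i) = {q i, q (s - i)}"
proof -
  have "(f ^^ 2) (q i) = q i" by (simp add: numeral_2_eq_2 f)
  then have "orbit f (q i) = {(f ^^ m) (q i) | m. m < 2}" by (rule orbit_altdef_bounded) simp
  also have "\<dots> = (\<lambda>m. (f ^^ m) (q i)) ` {..<2}" by auto
  also have "{..<2::nat} = {0, 1}" by auto
  finally show ?thesis by (simp add: f)
qed

lemma orbit_reflection_eq_image:
  fixes q :: "int \<Rightarrow> 'b"
  assumes per: "\<And>i j. q i = q j \<longleftrightarrow> int n dvd i - j" and f: "\<And>i. f (q i) = q (s - i)"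
  shows "orbit f (q i) = q ` {j. reflect_rep n s j = reflect_rep n s i}"
proof -
  have "q j \<in> {q i, q (s - i)}" if "reflect_rep n s j = reflect_rep n s i" for j
    using that by (auto simp: reflect_rep_eq_iff per)
  moreover have "q i \<in> q ` {j. reflect_rep n s j = reflect_rep n s i}"
    "q (s - i) \<in> q ` {j. reflect_rep n s j = reflect_rep n s i}"
    by (auto simp: reflect_rep_eq_iff)
  ultimately show ?thesis unfolding orbit_reflection[of f q s, OF f] by auto
qed

lemma card_orbit_reflection:
  fixes q :: "int \<Rightarrow> 'b"
  assumes per: "\<And>i j. q i = q j \<longleftrightarrow> int n dvd i - j" and f: "\<And>i. f (q i) = q (s - i)"
  shows "card (orbit f (q i)) = (if int n dvd 2 * i - s then 1 else 2)"
proof -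
  have "q i = q (s - i) \<longleftrightarrow> int n dvd 2 * i - s" by (simp add: per algebra_simps)
  then show ?thesis by (simp add: card_insert_if orbit_reflection[of f q s, OF f])
qed

text \<open>The classes of \<open>\<rho>\<close> index the orbits, and the fixed points of \<open>\<rho>\<close> are their representatives.\<close>

lemma orbits_by_representatives:
  fixes q :: "int \<Rightarrow> 'b" and \<rho> :: "int \<Rightarrow> int"
  assumes per: "\<And>i j. q i = q j \<Longrightarrow> \<rho> i = \<rho> j" and idem: "\<And>i. \<rho> (\<rho> i) = \<rho> i"
    and orb: "\<And>i. orbit f (q i) = q ` {j. \<rho> j = \<rho> i}"
  shows "inj_on (\<lambda>j. orbit f (q j)) (range \<rho>)"
    and "orbit f ` range q = (\<lambda>j. orbit f (q j)) ` range \<rho>"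
proof -
  have "\<rho> j = \<rho> i" if "orbit f (q j) = orbit f (q i)" for i j
  proof -
    have "q j \<in> orbit f (q i)" unfolding that[symmetric] by (simp add: orb)
    then obtain k where "q j = q k" "\<rho> k = \<rho> i" by (auto simp: orb)
    then show ?thesis using per by metis
  qed
  then show "inj_on (\<lambda>j. orbit f (q j)) (range \<rho>)" by (intro inj_onI, elim rangeE) (metis idem)
  have "orbit f (q i) = orbit f (q (\<rho> i))" for i by (simp add: orb idem)
  then show "orbit f ` range q = (\<lambda>j. orbit f (q j)) ` range \<rho>" by auto
qed

text \<open>Grouping the cycles by length turns the product over \<open>k\<close> in the weight into
  a product over single cycles. The bound \<open>N\<close> has to reach every length that
  occurs.\<close>

lemma prod_power_card_image:
  fixes x :: "nat \<Rightarrow> 'b::comm_semiring_1"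
  assumes "finite J" "inj_on C J" and N: "\<And>j. j \<in> J \<Longrightarrow> card (C j) \<in> {1..N}"
  shows "(\<Prod>k = 1..N. x k ^ card {D \<in> C ` J. card D = k \<and> Q D}) =
    (\<Prod>j\<in>J. if Q (C j) then x (card (C j)) else 1)"
proof -
  have "x k ^ card {D \<in> C ` J. card D = k \<and> Q D} =
      (\<Prod>j\<in>{j \<in> J. card (C j) = k}. if Q (C j) then x (card (C j)) else 1)" for k
  proof -
    have "{D \<in> C ` J. card D = k \<and> Q D} = C ` {j \<in> J. card (C j) = k \<and> Q (C j)}" by auto
    then have "card {D \<in> C ` J. card D = k \<and> Q D} = card {j \<in> J. card (C j) = k \<and> Q (C j)}"
      using assms(2) by (simp add: card_image inj_on_subset)
    then have "x k ^ card {D \<in> C ` J. card D = k \<and> Q D} =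
        (\<Prod>j\<in>{j \<in> J. card (C j) = k \<and> Q (C j)}. x (card (C j)))" by simp
    also have "\<dots> = (\<Prod>j\<in>{j \<in> {j \<in> J. card (C j) = k}. Q (C j)}. x (card (C j)))"
      by (intro prod.cong) auto
    also have "\<dots> = (\<Prod>j\<in>{j \<in> J. card (C j) = k}. if Q (C j) then x (card (C j)) else 1)"
      using assms(1) by (intro prod.inter_filter) simp
    finally show ?thesis .
  qed
  then have "(\<Prod>k = 1..N. x k ^ card {D \<in> C ` J. card D = k \<and> Q D}) =
      (\<Prod>k = 1..N. \<Prod>j\<in>{j \<in> J. card (C j) = k}. if Q (C j) then x (card (C j)) else 1)" by simp
  also have "\<dots> = (\<Prod>j\<in>J. if Q (C j) then x (card (C j)) else 1)"
    using assms by (intro prod.group) auto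
  finally show ?thesis .
qed

section \<open>Graphs labelled cyclically\<close>

text \<open>Labels are all integers, repeated with period \<open>n\<close>, so that index arithmetic
  needs no wrap-around and the origin can be moved freely.\<close>

locale cyclic_labelling =
  fixes G :: "'v graph" and n :: nat and p :: "int \<Rightarrow> 'v"
  assumes n_ge_3: "3 \<le> n"
    and p_eq_iff: "p i = p j \<longleftrightarrow> int n dvd i - j"
    and verts_eq: "verts G = range p"
    and edges_eq: "edges G = range (\<lambda>i. {p i, p (i + 1)})"
begin

definition E :: "int \<Rightarrow> 'v set" where "E i = {p i, p (i + 1)}"

lemma n_pos: "n > 0" using n_ge_3 by simp

lemma edges_eq_range: "edges G = range E" by (simp add: edges_eq E_def)

lemma not_dvd_small: "0 < \<bar>k\<bar> \<Longrightarrow> \<bar>k\<bar> < 3 \<Longrightarrow> \<not> int n dvd k"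
  using n_ge_3 by (auto dest!: dvd_imp_le_int)

lemma p_succ_neq: "p i \<noteq> p (i + 1)" "p (i + 1) \<noteq> p i"
  using n_ge_3 by (simp_all add: p_eq_iff)

lemma p_mem_E_iff: "p k \<in> E i \<longleftrightarrow> int n dvd k - i \<or> int n dvd k - (i + 1)"
  by (simp add: E_def p_eq_iff)

lemma E_eq_iff: "E i = E j \<longleftrightarrow> int n dvd i - j"
proof
  assume "E i = E j"
  then have "p i = p j \<or> p i = p (j + 1) \<and> p (i + 1) = p j"
    by (auto simp: E_def doubleton_eq_iff)
  then show "int n dvd i - j"
  proof
    assume *: "p i = p (j + 1) \<and> p (i + 1) = p j"
    \<comment> \<open>If the edges agreed with their ends exchanged, the difference of the two
      congruences would give that \<open>n\<close> divides 2, contrary to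
      \<open>n \<ge> 3\<close>.\<close>
    have "int n dvd (i + 1 - j) - (i - (j + 1))"
      using * unfolding p_eq_iff by (blast intro: dvd_diff)
    then show ?thesis using not_dvd_small[of 2] by simp
  qed (simp add: p_eq_iff)
next
  assume "int n dvd i - j"
  moreover from this have "int n dvd (i + 1) - (j + 1)" by simp
  ultimately show "E i = E j" by (simp only: E_def p_eq_iff[symmetric])
qed

lemma E_meets_iff: "E i \<inter> E j \<noteq> {} \<longleftrightarrow> E i = E j \<or> E i = E (j + 1) \<or> E j = E (i + 1)"
proof -
  have "E i \<inter> E j \<noteq> {} \<longleftrightarrow> p i \<in> E j \<or> p (i + 1) \<in> E j" by (auto simp: E_def)
  also have "\<dots> \<longleftrightarrow> E i = E j \<or> E i = E (j + 1) \<or> E (i + 1) = E j"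
    unfolding p_mem_E_iff E_eq_iff by auto
  finally show ?thesis by auto
qed

lemma E_succ_neq: "E i \<noteq> E (i + 1)" using n_ge_3 by (simp add: E_eq_iff)

lemma disjoint_edges_iff:
  assumes "\<mu> \<subseteq> range E"
  shows "disjoint \<mu> \<longleftrightarrow> (\<forall>i. E i \<in> \<mu> \<longrightarrow> E (i + 1) \<notin> \<mu>)"
proof
  assume d: "disjoint \<mu>"
  show "\<forall>i. E i \<in> \<mu> \<longrightarrow> E (i + 1) \<notin> \<mu>"
  proof (intro allI impI notI)
    fix i assume "E i \<in> \<mu>" "E (i + 1) \<in> \<mu>"
    then have "E i \<inter> E (i + 1) = {}" using d E_succ_neq by (metis disjointD)
    then show False by (auto simp: E_def)
  qed
next
  assume *: "\<forall>i. E i \<in> \<mu> \<longrightarrow> E (i + 1) \<notin> \<mu>"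
  show "disjoint \<mu>"
  proof (rule disjointI)
    fix e e' assume "e \<in> \<mu>" "e' \<in> \<mu>" "e \<noteq> e'"
    moreover obtain i j where "e = E i" "e' = E j" using assms calculation by blast
    ultimately show "e \<inter> e' = {}" using * E_meets_iff[of i j] by metis
  qed
qed

lemma card_verts: "card (verts G) = n"
  unfolding verts_eq by (rule card_range_residue_classes[OF n_pos p_eq_iff])

lemma card_edges: "card (edges G) = n"
  unfolding edges_eq_range by (rule card_range_residue_classes[OF n_pos E_eq_iff])

lemma finite_verts: "finite (verts G)" and finite_edges: "finite (edges G)"
  using card_verts card_edges n_pos card_gt_0_iff by metis+

text \<open>The ends of an edge are distinct, so the iterate cannot both fix and exchange them. This
  turns one-way knowledge of the type of a cycle into an equivalence.\<close>

lemma not_cylindrical_and_moebius: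
  assumes "E i \<in> C"
  shows "\<not> (cylindrical \<sigma> C \<and> moebius \<sigma> C)"
proof
  assume *: "cylindrical \<sigma> C \<and> moebius \<sigma> C"
  have mem: "p i \<in> E i" "p (i + 1) \<in> E i" by (simp_all add: E_def)
  have "(\<sigma> ^^ card C) (p i) = p i"
    using * assms mem unfolding cylindrical_def by blast
  moreover have "(\<sigma> ^^ card C) (p i) = p (i + 1)"
    using * assms mem p_succ_neq(1) unfolding moebius_def by blast
  ultimately show False using p_succ_neq(1) by metis
qed

lemma matching_poly_eq_cyclic_sparse_sum:
  "matching_poly G y z = sparse_sum (\<lambda>i. i mod int n) {0..<int n} (\<lambda>_. y) (\<lambda>_. z)"
proof (rule matching_poly_eq_sparse_sum[of E])
  have inj: "inj_on E {0..<int n}"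
    by (rule inj_onI) (metis E_eq_iff atLeastLessThan_iff mod_eq_dvd_iff mod_pos_pos_trivial)
  then show "bij_betw E {0..<int n} (edges G)"
    using image_residue_classes[of n E] n_pos by (simp add: bij_betw_def edges_eq_range E_eq_iff)
  fix S assume S: "S \<subseteq> {0..<int n}"
  have "E i \<in> E ` S \<longleftrightarrow> i mod int n \<in> S" for i
  proof
    assume "E i \<in> E ` S"
    then obtain j where j: "j \<in> S" "E i = E j" by auto
    then have "i mod int n = j mod int n" by (simp only: E_eq_iff mod_eq_dvd_iff)
    also have "\<dots> = j" using j S by auto
    finally show "i mod int n \<in> S" using j by simp
  next
    assume "i mod int n \<in> S"
    moreover have "E i = E (i mod int n)" by (simp add: E_eq_iff minus_mod_eq_mult_div)
    ultimately show "E i \<in> E ` S" by blast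
  qed
  moreover have "disjoint (E ` S) \<longleftrightarrow> (\<forall>i. E i \<in> E ` S \<longrightarrow> E (i + 1) \<notin> E ` S)"
    by (rule disjoint_edges_iff) auto
  ultimately show "disjoint (E ` S) \<longleftrightarrow> (\<forall>i. i mod int n \<in> S \<longrightarrow> (i + 1) mod int n \<notin> S)"
    by simp
qed simp

text \<open>The common reduction for rotations and reflections. A set \<open>S\<close> of
  representatives corresponds to the union \<open>M S\<close> of their edge cycles, and sort Y means
  membership in \<open>S\<close>. The parameters \<open>cyl\<close> and \<open>len\<close> record
  type and length of the cycle of each representative; vertex cycles do not depend on the matching
  and factor out.\<close>

lemma sum_fixed_matchings:
  fixes a b c \<beta> \<gamma> :: "nat \<Rightarrow> 'b::comm_semiring_1"
  assumes perm: "\<sigma> permutes verts G"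
    and orb: "\<And>i. orbit ((`) \<sigma>) (E i) = E ` {j. \<rho> j = \<rho> i}"
    and per: "\<And>i j. int n dvd i - j \<Longrightarrow> \<rho> i = \<rho> j"
    and idem: "\<And>i. \<rho> (\<rho> i) = \<rho> i"
    and cyl: "\<And>i. cyl (\<rho> i) \<Longrightarrow> cylindrical \<sigma> (orbit ((`) \<sigma>) (E (\<rho> i)))"
    and moeb: "\<And>i. \<not> cyl (\<rho> i) \<Longrightarrow> moebius \<sigma> (orbit ((`) \<sigma>) (E (\<rho> i)))"
    and len: "\<And>i. card (orbit ((`) \<sigma>) (E (\<rho> i))) = len (\<rho> i)"
  shows "(\<Sum>\<mu>\<in>fixed_matchings G \<sigma>. walsh_weight G a b c \<beta> \<gamma> \<sigma> \<mu>) =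
    (\<Prod>D\<in>vertex_cycles G \<sigma>. a (card D)) *
    sparse_sum \<rho> (range \<rho>) (\<lambda>j. if cyl j then b (len j) else c (len j))
      (\<lambda>j. if cyl j then \<beta> (len j) else \<gamma> (len j))"
proof -
  let ?J = "range \<rho>"
  let ?A = "{S. S \<subseteq> ?J \<and> (\<forall>i. \<rho> i \<in> S \<longrightarrow> \<rho> (i + 1) \<notin> S)}"
  define C where "C = (\<lambda>j. orbit ((`) \<sigma>) (E j))"
  define M where "M = (\<lambda>S. E ` {i. \<rho> i \<in> S})"
  have finJ: "finite ?J" using image_residue_classes[of n \<rho>] n_pos per by simp
  have E_per: "E i = E j \<Longrightarrow> \<rho> i = \<rho> j" for i j using per E_eq_iff by blast
  have injC: "inj_on C ?J" and edge_cycles: "edge_cycles G \<sigma> = C ` ?J"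
    using orbits_by_representatives[of E \<rho> "(`) \<sigma>", OF E_per idem orb]
    by (simp_all add: C_def edge_cycles_def edges_eq_range)
  have M_iff: "E i \<in> M S \<longleftrightarrow> \<rho> i \<in> S" for i S
  proof
    assume "E i \<in> M S"
    then obtain k where "E i = E k" "\<rho> k \<in> S" by (auto simp: M_def)
    then show "\<rho> i \<in> S" using E_per by metis
  qed (auto simp: M_def)
  have injM: "inj_on M ?A"
  proof (rule inj_on_inverseI)
    fix S assume "S \<in> ?A"
    then show "{j \<in> ?J. E j \<in> M S} = S" by (auto simp: M_iff idem)
  qed
  have C_edges: "C j \<subseteq> range E" for j by (auto simp: C_def orb)
  have card_C: "card (C j) \<in> {1..n}" if "j \<in> ?J" for j
  proof -
    have "finite (C j)" using C_edges finite_edges finite_subset edges_eq_range by metis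
    moreover have "C j \<noteq> {}" by (simp add: C_def orbit_nonempty)
    moreover have "card (C j) \<le> n"
      using C_edges card_mono[OF finite_edges] card_edges edges_eq_range by metis
    ultimately show ?thesis by (simp add: Suc_le_eq card_gt_0_iff)
  qed
  have fixed: "fixed_matchings G \<sigma> = M ` ?A"
  proof (intro set_eqI iffI)
    fix \<mu> assume \<mu>: "\<mu> \<in> fixed_matchings G \<sigma>"
    then have sub: "\<mu> \<subseteq> range E" and disj: "disjoint \<mu>" and inv: "(`) \<sigma> ` \<mu> = \<mu>"
      by (auto simp: fixed_matchings_def matchings_def edges_eq_range)
    have closed: "E j \<in> \<mu>" if "E i \<in> \<mu>" "\<rho> j = \<rho> i" for i j
    proof -
      have "e \<in> \<mu>" if "e \<in> orbit ((`) \<sigma>) (E i)" for e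
        using that by induction (use \<open>E i \<in> \<mu>\<close> inv in blast)+
      then show ?thesis using that(2) by (auto simp: orb)
    qed
    define S where "S = {j \<in> ?J. E j \<in> \<mu>}"
    have E_mem: "E i \<in> \<mu> \<longleftrightarrow> \<rho> i \<in> S" for i
      using closed idem by (auto simp: S_def)
    then have "\<mu> = M S" using sub by (auto simp: M_def)
    moreover have "\<forall>i. \<rho> i \<in> S \<longrightarrow> \<rho> (i + 1) \<notin> S"
      using disj unfolding disjoint_edges_iff[OF sub] E_mem .
    moreover have "S \<subseteq> ?J" by (auto simp: S_def)
    ultimately show "\<mu> \<in> M ` ?A" by blast
  next
    fix \<mu> assume "\<mu> \<in> M ` ?A"
    then obtain S where S: "\<mu> = M S" "S \<in> ?A" by blast
    have sub: "\<mu> \<subseteq> range E" by (auto simp: S M_def)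
    then have fin: "finite \<mu>" using finite_edges edges_eq_range finite_subset by metis
    \<comment> \<open>Inclusion is enough: the induced map on edges is injective and
      \<open>\<mu>\<close> is finite.\<close>
    have "(`) \<sigma> ` \<mu> \<subseteq> \<mu>"
    proof
      fix e assume "e \<in> (`) \<sigma> ` \<mu>"
      then obtain i where i: "e = \<sigma> ` E i" "\<rho> i \<in> S" by (auto simp: S M_def)
      have "e \<in> orbit ((`) \<sigma>) (E i)" unfolding i by (rule orbit.base)
      then obtain j where "e = E j" "\<rho> j = \<rho> i" by (auto simp: orb)
      then show "e \<in> \<mu>" using i by (auto simp: S M_def)
    qed
    moreover have "inj_on ((`) \<sigma>) \<mu>"
      by (rule inj_onI) (metis perm permutes_inj inj_image_eq_iff)
    ultimately have "(`) \<sigma> ` \<mu> = \<mu>" using fin by (simp add: endo_inj_surj)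
    moreover have "disjoint \<mu>"
      unfolding disjoint_edges_iff[OF sub] unfolding S(1) M_iff using S(2) by blast
    ultimately show "\<mu> \<in> fixed_matchings G \<sigma>"
      using sub by (auto simp: fixed_matchings_def matchings_def edges_eq_range)
  qed
  have weight: "walsh_weight G a b c \<beta> \<gamma> \<sigma> (M S) = (\<Prod>D\<in>vertex_cycles G \<sigma>. a (card D)) *
      (\<Prod>j\<in>?J. if j \<in> S then (if cyl j then b (len j) else c (len j))
        else (if cyl j then \<beta> (len j) else \<gamma> (len j)))" if "S \<in> ?A" for S
  proof -
    have sub: "C j \<subseteq> M S \<longleftrightarrow> j \<in> S" and meet: "C j \<inter> M S = {} \<longleftrightarrow> j \<notin> S" if "j \<in> ?J" for j
      using that by (auto simp: C_def orb M_iff idem)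
    have cyl_iff: "cylindrical \<sigma> (C j) \<longleftrightarrow> cyl j" and moeb_iff: "moebius \<sigma> (C j) \<longleftrightarrow> \<not> cyl j"
      if j: "j \<in> ?J" for j
    proof -
      have "E j \<in> C j" by (simp add: C_def orb)
      then show "cylindrical \<sigma> (C j) \<longleftrightarrow> cyl j" "moebius \<sigma> (C j) \<longleftrightarrow> \<not> cyl j"
        using j cyl moeb not_cylindrical_and_moebius unfolding C_def by blast+
    qed
    have len_C: "card (C j) = len j" if "j \<in> ?J" for j using that len by (auto simp: C_def)
    note prods = prod_power_card_image[OF finJ injC card_C, folded edge_cycles]
    have vert: "(\<Prod>k = 1..n. a k ^ vcyc G \<sigma> k) = (\<Prod>D\<in>vertex_cycles G \<sigma>. a (card D))"
    proof -
      have "card D \<in> {1..n}" if D: "D \<in> vertex_cycles G \<sigma>" for D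
      proof -
        obtain v where v: "D = orbit \<sigma> v" "v \<in> verts G" using D by (auto simp: vertex_cycles_def)
        have "x \<in> verts G" if "x \<in> orbit \<sigma> v" for x
          using that by induction (simp_all add: permutes_in_image[OF perm] v)
        then have "D \<subseteq> verts G" using v by auto
        then have "finite D" "card D \<le> n"
          using finite_verts finite_subset card_mono card_verts by metis+
        moreover have "D \<noteq> {}" by (simp add: v orbit_nonempty)
        ultimately show ?thesis by (simp add: Suc_le_eq card_gt_0_iff)
      qed
      moreover have "finite (vertex_cycles G \<sigma>)" by (simp add: vertex_cycles_def finite_verts)
      ultimately show ?thesis
        using prod_power_card_image[of "vertex_cycles G \<sigma>" "\<lambda>D. D" n a "\<lambda>_. True"]
        by (simp add: vcyc_def)
    qed
    \<comment> \<open>For each cycle exactly one of the four conditions holds, so three of the four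
      factors are 1.\<close>
    have "walsh_weight G a b c \<beta> \<gamma> \<sigma> (M S) = (\<Prod>D\<in>vertex_cycles G \<sigma>. a (card D)) *
      (\<Prod>j\<in>?J. (if cylindrical \<sigma> (C j) \<and> C j \<subseteq> M S then b (card (C j)) else 1) *
        (if moebius \<sigma> (C j) \<and> C j \<subseteq> M S then c (card (C j)) else 1) *
        (if cylindrical \<sigma> (C j) \<and> C j \<inter> M S = {} then \<beta> (card (C j)) else 1) *
        (if moebius \<sigma> (C j) \<and> C j \<inter> M S = {} then \<gamma> (card (C j)) else 1))"
      unfolding walsh_weight_def card_verts card_edges max.idem prod.distrib vert
        cyl_Y_def moeb_Y_def cyl_Z_def moeb_Z_def
      by (simp only: prods mult.assoc)
    also have "\<dots> = (\<Prod>D\<in>vertex_cycles G \<sigma>. a (card D)) *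
      (\<Prod>j\<in>?J. if j \<in> S then (if cyl j then b (len j) else c (len j))
        else (if cyl j then \<beta> (len j) else \<gamma> (len j)))"
      by (intro arg_cong2[of _ _ _ _ "(*)"] prod.cong refl)
        (auto simp only: sub meet cyl_iff moeb_iff len_C split: if_splits, simp_all)
    finally show ?thesis .
  qed
  show ?thesis
    unfolding fixed sum.reindex[OF injM] sparse_sum_def sum_distrib_left
    by (intro sum.cong refl) (simp add: weight)
qed

end

lemma prod_orbits_by_representatives:
  fixes q :: "int \<Rightarrow> 'b" and \<rho> :: "int \<Rightarrow> int" and a :: "nat \<Rightarrow> 'c::comm_monoid_mult"
  assumes per: "\<And>i j. q i = q j \<Longrightarrow> \<rho> i = \<rho> j" and idem: "\<And>i. \<rho> (\<rho> i) = \<rho> i"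
    and orb: "\<And>i. orbit f (q i) = q ` {j. \<rho> j = \<rho> i}"
  shows "(\<Prod>D\<in>orbit f ` range q. a (card D)) = (\<Prod>j\<in>range \<rho>. a (card (orbit f (q j))))"
proof -
  have reps: "inj_on (\<lambda>j. orbit f (q j)) (range \<rho>)"
    "orbit f ` range q = (\<lambda>j. orbit f (q j)) ` range \<rho>"
    using orbits_by_representatives[of q \<rho> f, OF per idem orb] by simp_all
  show ?thesis unfolding reps(2) by (simp only: prod.reindex[OF reps(1)] comp_def)
qed

section \<open>The standard cycle graph and the polynomials \<open>cycle_T\<close>\<close>

lemma range_mod: "d > 0 \<Longrightarrow> range (\<lambda>i. i mod int d) = {0..<int d}"
  using image_residue_classes[of d "\<lambda>i. i mod int d"] by (simp add: mod_eq_dvd_iff)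

lemma cyclic_labelling_cycle_graph:
  assumes "n \<ge> 3"
  shows "cyclic_labelling (cycle_graph n) n (\<lambda>i. nat (i mod int n) + 1)"
proof
  let ?p = "\<lambda>i. nat (i mod int n) + 1"
  have n: "int n > 0" using assms by simp
  show "n \<ge> 3" by fact
  fix i j
  have "?p i = ?p j \<longleftrightarrow> i mod int n = j mod int n"
    using n pos_mod_sign[of "int n" i] pos_mod_sign[of "int n" j] by (simp add: eq_nat_nat_iff)
  then show "?p i = ?p j \<longleftrightarrow> int n dvd i - j" by (simp only: mod_eq_dvd_iff)
next
  let ?p = "\<lambda>i. nat (i mod int n) + 1"
  have n: "int n > 0" using assms by simp
  have p_nat: "?p (int k) = k + 1" if "k < n" for k using that by simp
  have p_mod: "?p i = nat (i mod int n) + 1" "nat (i mod int n) < n" for i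
    using n by (simp_all add: nat_less_iff)
  show "verts (cycle_graph n) = range ?p"
  proof (intro set_eqI iffI)
    fix v assume "v \<in> verts (cycle_graph n)"
    then have "v = ?p (int (v - 1))" by (auto simp: cycle_graph_def)
    then show "v \<in> range ?p" by blast
  next
    fix v assume "v \<in> range ?p"
    then show "v \<in> verts (cycle_graph n)" using p_mod by (auto simp: cycle_graph_def Suc_le_eq)
  qed
  have edge: "{?p (int k), ?p (int k + 1)} = (if k + 1 < n then {k + 1, k + 1 + 1} else {n, 1})"
    if "k < n" for k
  proof (cases "k + 1 < n")
    case True
    then have "?p (int k + 1) = k + 1 + 1" using p_nat[of "k + 1"] by (simp add: add.commute)
    then show ?thesis using True p_nat[OF that] by (simp only: if_True)
  next
    case False
    then have "k + 1 = n" using that by simp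
    then have "int k + 1 = int n" by simp
    then show ?thesis using False p_nat[OF that] \<open>k + 1 = n\<close> by (simp only: if_False) simp
  qed
  have reduce: "{?p i, ?p (i + 1)} = {?p (int (nat (i mod int n))), ?p (int (nat (i mod int n)) + 1)}" for i
    using n by (simp add: mod_add_left_eq)
  show "edges (cycle_graph n) = range (\<lambda>i. {?p i, ?p (i + 1)})"
  proof (intro set_eqI iffI)
    fix e assume "e \<in> edges (cycle_graph n)"
    then consider i where "e = {i, i + 1}" "1 \<le> i" "i < n" | "e = {n, 1}"
      by (auto simp: cycle_graph_def)
    then have "\<exists>k<n. e = {?p (int k), ?p (int k + 1)}"
    proof cases
      case 1
      then show ?thesis using edge[of "i - 1"] by (intro exI[of _ "i - 1"]) simp
    next
      case 2
      then show ?thesis using edge[of "n - 1"] assms by (intro exI[of _ "n - 1"]) simp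
    qed
    then show "e \<in> range (\<lambda>i. {?p i, ?p (i + 1)})" by blast
  next
    fix e assume "e \<in> range (\<lambda>i. {?p i, ?p (i + 1)})"
    then obtain i where "e = {?p i, ?p (i + 1)}" by blast
    then have "\<exists>k<n. e = (if k + 1 < n then {k + 1, k + 1 + 1} else {n, 1})"
      using reduce[of i] edge p_mod(2)[of i] by metis
    then show "e \<in> edges (cycle_graph n)"
      by (auto simp: cycle_graph_def split: if_splits)
  qed
qed

text \<open>This explains the conventions for small indices. For \<open>n = 1\<close> the only class
  is adjacent to itself, as a loop, and stays unmatched, giving \<open>z\<close>. For
  \<open>n = 2\<close> there are two parallel edges, of which at most one is matched, giving
  \<open>2 * y * z + z ^ 2\<close>.\<close>

lemma cycle_T_eq_sparse_sum:
  assumes "n > 0"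
  shows "cycle_T n y z = sparse_sum (\<lambda>i. i mod int n) {0..<int n} (\<lambda>_. y) (\<lambda>_. z)"
proof -
  consider "n = 1" | "n = 2" | "n \<ge> 3" using assms by linarith
  then show ?thesis
  proof cases
    case 1
    have "{S. S \<subseteq> {0} \<and> 0 \<notin> S} = {{} :: int set}" "{0..<1} = {0::int}" by auto
    then show ?thesis using 1 by (simp add: cycle_T_def sparse_sum_def)
  next
    case 2
    have J: "{0..<2} = {0, 1::int}" by auto
    have "{S. S \<subseteq> {0, 1} \<and> (\<forall>i. i mod 2 \<in> S \<longrightarrow> (i + 1) mod 2 \<notin> S)} = {{}, {0}, {1::int}}"
    proof (intro set_eqI iffI)
      fix S :: "int set" assume S: "S \<in> {S. S \<subseteq> {0, 1} \<and> (\<forall>i. i mod 2 \<in> S \<longrightarrow> (i + 1) mod 2 \<notin> S)}"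
      then have "0 mod 2 \<in> S \<longrightarrow> (0 + 1) mod 2 \<notin> S" by blast
      then have "0 \<in> S \<longrightarrow> 1 \<notin> S" by simp
      then show "S \<in> {{}, {0}, {1}}" using S by auto
    next
      fix S :: "int set" assume S: "S \<in> {{}, {0}, {1}}"
      have step: "i mod 2 = 0 \<Longrightarrow> (i + 1) mod 2 \<noteq> 0" "i mod 2 = 1 \<Longrightarrow> (i + 1) mod 2 \<noteq> 1" for i :: int
        by presburger+
      consider "S = {}" | "S = {0}" | "S = {1}" using S by blast
      then show "S \<in> {S. S \<subseteq> {0, 1} \<and> (\<forall>i. i mod 2 \<in> S \<longrightarrow> (i + 1) mod 2 \<notin> S)}"
        by cases (simp_all only: mem_Collect_eq singleton_iff empty_iff, use step in \<open>blast+\<close>)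
    qed
    then show ?thesis
      using 2 by (simp add: cycle_T_def sparse_sum_def J power2_eq_square algebra_simps)
  next
    case 3
    interpret cyclic_labelling "cycle_graph n" n "\<lambda>i. nat (i mod int n) + 1"
      by (rule cyclic_labelling_cycle_graph[OF 3])
    show ?thesis using 3 matching_poly_eq_cyclic_sparse_sum by (simp add: cycle_T_def)
  qed
qed

text \<open>The factor \<open>z\<close> in the first equation covers \<open>k = 0\<close>, where \<open>path_U 0 y z = 1 / z\<close>, even for
  \<open>z = 0\<close>.\<close>

lemma sparse_sum_path_end:
  "z * sparse_sum (\<lambda>i. i) {l..l + int k} (\<lambda>j. if j = l then y' else y) (\<lambda>j. if j = l then z' else z) =
    z * z' * path_U (Suc k) y z + y' * z ^ 2 * path_U k y z"
  "k > 0 \<Longrightarrow>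
    sparse_sum (\<lambda>i. i) {l..l + int k} (\<lambda>j. if j = l then y' else y) (\<lambda>j. if j = l then z' else z) =
    z' * path_U (Suc k) y z + y' * z * path_U k y z"
proof -
  let ?Y = "\<lambda>j. if j = l then y' else y" and ?Z = "\<lambda>j. if j = l then z' else z"
  let ?J = "{l + 1..<l + 1 + int k}"
  have J: "{l..l + int k} = insert l ?J" by auto
  have "sparse_sum (\<lambda>i. i) {l..l + int k} ?Y ?Z =
      z' * sparse_sum (\<lambda>i. i) ?J ?Y ?Z +
      y' * (prod ?Z (?J \<inter> {l - 1, l + 1}) * sparse_sum (\<lambda>i. i) (?J - {l - 1, l + 1}) ?Y ?Z)"
    unfolding J by (subst sparse_sum_insert) simp_all
  also have "sparse_sum (\<lambda>i. i) ?J ?Y ?Z = path_U (Suc k) y z"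
    unfolding path_U_eq_sparse_sum[of k y z "l + 1"] by (rule sparse_sum_cong) auto
  finally have *: "sparse_sum (\<lambda>i. i) {l..l + int k} ?Y ?Z = z' * path_U (Suc k) y z +
      y' * (prod ?Z (?J \<inter> {l - 1, l + 1}) * sparse_sum (\<lambda>i. i) (?J - {l - 1, l + 1}) ?Y ?Z)" .
  have pos: "prod ?Z (?J \<inter> {l - 1, l + 1}) * sparse_sum (\<lambda>i. i) (?J - {l - 1, l + 1}) ?Y ?Z =
      z * path_U k y z" if k: "k > 0"
  proof -
    obtain k' where k': "k = Suc k'" using k gr0_implies_Suc by blast
    have "?J \<inter> {l - 1, l + 1} = {l + 1}" "?J - {l - 1, l + 1} = {l + 2..<l + 2 + int k'}"
      using k' by auto
    moreover have "sparse_sum (\<lambda>i. i) {l + 2..<l + 2 + int k'} ?Y ?Z = path_U k y z"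
      unfolding k' path_U_eq_sparse_sum[of k' y z "l + 2"] by (rule sparse_sum_cong) auto
    ultimately show ?thesis by simp
  qed
  show "sparse_sum (\<lambda>i. i) {l..l + int k} ?Y ?Z = z' * path_U (Suc k) y z + y' * z * path_U k y z"
    if "k > 0"
    using * pos that by (simp add: mult.assoc)
  show "z * sparse_sum (\<lambda>i. i) {l..l + int k} ?Y ?Z =
      z * z' * path_U (Suc k) y z + y' * z ^ 2 * path_U k y z"
  proof (cases "k = 0")
    case True
    have "z ^ 2 * path_U 0 y z = z" by (simp add: path_U_def power2_eq_square)
    then show ?thesis unfolding * using True by (simp add: algebra_simps)
  next
    case False
    then show ?thesis unfolding * using pos by (simp add: algebra_simps power2_eq_square)
  qed
qed

text \<open>In the quotient of a cycle by a reflection, the classes in \<open>B\<close> are those that contain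
  two neighbouring edges.\<close>

lemma sparse_walk_iff:
  fixes \<rho> :: "int \<Rightarrow> int"
  assumes step: "\<And>i. \<rho> (i + 1) = \<rho> i + 1 \<or> \<rho> i = \<rho> (i + 1) + 1 \<or> \<rho> (i + 1) = \<rho> i \<and> \<rho> i \<in> B"
    and fix_: "\<And>j. j \<in> J \<Longrightarrow> j + 1 \<in> J \<Longrightarrow> \<rho> j = j \<and> \<rho> (j + 1) = j + 1"
    and stay: "\<And>j. j \<in> B \<Longrightarrow> \<exists>i. \<rho> i = j \<and> \<rho> (i + 1) = j"
    and "S \<subseteq> J"
  shows "(\<forall>i. \<rho> i \<in> S \<longrightarrow> \<rho> (i + 1) \<notin> S) \<longleftrightarrow> S \<inter> B = {} \<and> (\<forall>i. i \<in> S \<longrightarrow> i + 1 \<notin> S)"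
proof
  assume *: "\<forall>i. \<rho> i \<in> S \<longrightarrow> \<rho> (i + 1) \<notin> S"
  have "j \<notin> S" if "j \<in> B" for j using stay[OF that] * by metis
  moreover have "j + 1 \<notin> S" if "j \<in> S" for j using that fix_[of j] * \<open>S \<subseteq> J\<close> by (metis subsetD)
  ultimately show "S \<inter> B = {} \<and> (\<forall>i. i \<in> S \<longrightarrow> i + 1 \<notin> S)" by blast
next
  assume *: "S \<inter> B = {} \<and> (\<forall>i. i \<in> S \<longrightarrow> i + 1 \<notin> S)"
  show "\<forall>i. \<rho> i \<in> S \<longrightarrow> \<rho> (i + 1) \<notin> S"
  proof (intro allI impI notI)
    fix i assume "\<rho> i \<in> S" "\<rho> (i + 1) \<in> S"
    then show False using step[of i] * by (metis disjoint_iff)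
  qed
qed

section \<open>Explicit foldings of the index circle by \<open>- i\<close> and
  \<open>- 1 - i\<close>\<close>

lemma int_mod_succ:
  assumes "n > 0"
  shows "(i + 1) mod int n = (if i mod int n = int n - 1 then 0 else i mod int n + 1)"
proof -
  have "(i + 1) mod int n = (i mod int n + 1) mod int n" by (simp add: mod_add_left_eq)
  moreover have "0 \<le> i mod int n" "i mod int n < int n" using assms by simp_all
  ultimately show ?thesis by (auto intro: mod_pos_pos_trivial)
qed

lemma reflect_rep_0:
  "n > 0 \<Longrightarrow> reflect_rep n 0 i = (if 2 * (i mod int n) \<le> int n then i mod int n else int n - i mod int n)"
  unfolding reflect_rep_def diff_0 zmod_zminus1_eq_if min_def
  using pos_mod_sign[of "int n" i] by (auto split: if_splits)

lemma reflect_rep_minus_1: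
  "n > 0 \<Longrightarrow> reflect_rep n (- 1) i = min (i mod int n) (int n - 1 - i mod int n)"
proof -
  assume n: "n > 0"
  have "- 1 - i = - (i + 1)" by simp
  then have "(- 1 - i) mod int n = (- (i + 1)) mod int n" by (simp only:)
  also have "\<dots> = int n - 1 - i mod int n"
  proof -
    have "i mod int n + 1 \<noteq> 0" using pos_mod_sign[of "int n" i] n by linarith
    then show ?thesis unfolding zmod_zminus1_eq_if int_mod_succ[OF n] by auto
  qed
  finally show ?thesis by (simp add: reflect_rep_def)
qed

lemma range_reflect_rep_0:
  assumes "n > 0"
  shows "range (reflect_rep n 0) = {0..int (n div 2)}"
proof (intro set_eqI iffI)
  fix j assume "j \<in> {0..int (n div 2)}"
  then have "reflect_rep n 0 j = j" using assms by (auto simp: reflect_rep_0)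
  then show "j \<in> range (reflect_rep n 0)" by (metis rangeI)
next
  fix j assume "j \<in> range (reflect_rep n 0)"
  then obtain i where i: "j = reflect_rep n 0 i" by blast
  have "0 \<le> i mod int n" "i mod int n < int n" using assms by simp_all
  then show "j \<in> {0..int (n div 2)}" unfolding i reflect_rep_0[OF assms] by auto
qed

lemma range_reflect_rep_minus_1:
  assumes "n > 0"
  shows "range (reflect_rep n (- 1)) = {0..int ((n - 1) div 2)}"
proof (intro set_eqI iffI)
  fix j assume j: "j \<in> {0..int ((n - 1) div 2)}"
  then have "2 * j \<le> int n - 1" "0 \<le> j" using assms by auto
  then have "reflect_rep n (- 1) j = j" using assms by (simp add: reflect_rep_minus_1)
  then show "j \<in> range (reflect_rep n (- 1))" by (metis rangeI)
next
  fix j assume "j \<in> range (reflect_rep n (- 1))"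
  then obtain i where i: "j = reflect_rep n (- 1) i" by blast
  have "0 \<le> i mod int n" "i mod int n < int n" using assms by simp_all
  then show "j \<in> {0..int ((n - 1) div 2)}" unfolding i reflect_rep_minus_1[OF assms] by auto
qed

section \<open>Sums over the matchings fixed by a rotation or a reflection\<close>

context cyclic_labelling
begin

text \<open>Moving the origin replaces conjugation by a rotation: it brings the centre of any
  reflection to a standard place.\<close>

lemma cyclic_labelling_shift: "cyclic_labelling G n (\<lambda>i. p (i + t))"
proof
  have surj: "\<exists>i'. i = i' + t" for i :: int by (metis diff_add_cancel)
  have img: "range (\<lambda>i. f (i + t)) = range f" for f :: "int \<Rightarrow> 'c"
    using surj by (auto simp: image_def) metis
  show "3 \<le> n" by (rule n_ge_3)
  show "p (i + t) = p (j + t) \<longleftrightarrow> int n dvd i - j" for i j by (simp add: p_eq_iff)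
  show "verts G = range (\<lambda>i. p (i + t))" unfolding verts_eq by (rule img[symmetric])
  show "edges G = range (\<lambda>i. {p (i + t), p (i + 1 + t)})"
    using img[of "\<lambda>i. {p i, p (i + 1)}"] by (simp add: edges_eq add.commute add.left_commute)
qed

lemma sum_rotation:
  fixes a b c \<beta> \<gamma> :: "nat \<Rightarrow> 'b::field"
  assumes perm: "\<sigma> permutes verts G" and \<sigma>: "\<And>i. \<sigma> (p i) = p (i + int r)"
    and d: "d = gcd r n"
  shows "(\<Sum>\<mu>\<in>fixed_matchings G \<sigma>. walsh_weight G a b c \<beta> \<gamma> \<sigma> \<mu>) =
    a (n div d) ^ d * cycle_T d (b (n div d)) (\<beta> (n div d))"
proof -
  let ?\<rho> = "\<lambda>i. i mod int d"
  have d_pos: "d > 0" and "d dvd n" "d dvd r" using n_pos by (simp_all add: d)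
  have \<rho>_iff: "{j. int d dvd j - i} = {j. ?\<rho> j = ?\<rho> i}" for i by (simp only: mod_eq_dvd_iff)
  have "\<sigma> ` E i = E (i + int r)" for i by (simp add: E_def \<sigma> ac_simps)
  note orbE = orbit_rotation[of n E "(`) \<sigma>" r, OF n_pos E_eq_iff this, folded d]
  note orbV = orbit_rotation[of n p \<sigma> r, OF n_pos p_eq_iff \<sigma>, folded d]
  have cardE: "card (orbit ((`) \<sigma>) (E i)) = n div d" for i
    unfolding orbE by (rule card_image_residue_subclass[OF n_pos \<open>d dvd n\<close> E_eq_iff])
  have cardV: "card (orbit \<sigma> (p i)) = n div d" for i
    unfolding orbV by (rule card_image_residue_subclass[OF n_pos \<open>d dvd n\<close> p_eq_iff])
  have pow: "(\<sigma> ^^ k) (p i) = p (i + int k * int r)" for k i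
    by (induction k) (simp_all add: \<sigma> algebra_simps)
  \<comment> \<open>As \<open>d\<close> divides \<open>r\<close>, the power \<open>n div d\<close>
    of the rotation shifts by a multiple of \<open>n\<close> and fixes every vertex. Hence no edge
    cycle is reversed.\<close>
  have "n dvd (n div d) * r"
    using \<open>d dvd n\<close> \<open>d dvd r\<close> by (metis dvd_div_mult_self mult.commute mult_dvd_mono dvd_refl)
  then have "int n dvd int (n div d) * int r" by (metis of_nat_dvd_iff of_nat_mult)
  then have "(\<sigma> ^^ (n div d)) (p i) = p i" for i by (simp add: pow p_eq_iff)
  then have cyl: "cylindrical \<sigma> (orbit ((`) \<sigma>) (E i))" for i
    unfolding cylindrical_def cardE unfolding orbE by (auto simp: E_def)
  have per: "?\<rho> i = ?\<rho> j" if "int n dvd i - j" for i j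
    using that \<open>d dvd n\<close> by (metis dvd_trans mod_eq_dvd_iff of_nat_dvd_iff)
  have "(\<Sum>\<mu>\<in>fixed_matchings G \<sigma>. walsh_weight G a b c \<beta> \<gamma> \<sigma> \<mu>) =
    (\<Prod>D\<in>vertex_cycles G \<sigma>. a (card D)) *
    sparse_sum ?\<rho> (range ?\<rho>) (\<lambda>j. if True then b (n div d) else c (n div d))
      (\<lambda>j. if True then \<beta> (n div d) else \<gamma> (n div d))"
    by (rule sum_fixed_matchings[OF perm orbE[unfolded \<rho>_iff]]) (simp_all add: cyl cardE per)
  also have "(\<Prod>D\<in>vertex_cycles G \<sigma>. a (card D)) = (\<Prod>j\<in>range ?\<rho>. a (card (orbit \<sigma> (p j))))"
    unfolding vertex_cycles_def verts_eq
    by (rule prod_orbits_by_representatives) (auto simp: orbV \<rho>_iff p_eq_iff per)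
  also have "\<dots> = a (n div d) ^ d" by (simp add: cardV range_mod[OF d_pos])
  finally show ?thesis by (simp add: range_mod[OF d_pos] cycle_T_eq_sparse_sum[OF d_pos])
qed

lemma vertex_cycles_reflection:
  fixes a :: "nat \<Rightarrow> 'b::comm_monoid_mult"
  assumes \<sigma>: "\<And>i. \<sigma> (p i) = p (s - i)"
  shows "(\<Prod>D\<in>vertex_cycles G \<sigma>. a (card D)) =
    (\<Prod>j\<in>range (reflect_rep n s). a (if int n dvd 2 * j - s then 1 else 2))"
proof -
  note card = card_orbit_reflection[of p n \<sigma> s, OF p_eq_iff \<sigma>]
  have "(\<Prod>D\<in>vertex_cycles G \<sigma>. a (card D)) =
      (\<Prod>j\<in>range (reflect_rep n s). a (card (orbit \<sigma> (p j))))"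
    unfolding vertex_cycles_def verts_eq
  proof (rule prod_orbits_by_representatives)
    show "reflect_rep n s i = reflect_rep n s j" if "p i = p j" for i j
      using that by (simp add: reflect_rep_eq_iff p_eq_iff)
    show "orbit \<sigma> (p i) = p ` {j. reflect_rep n s j = reflect_rep n s i}" for i
      by (rule orbit_reflection_eq_image[of p n \<sigma> s, OF p_eq_iff \<sigma>])
  qed (rule reflect_rep_idem)
  then show ?thesis by (simp only: card)
qed

text \<open>The constant for vertices is \<open>s + 1\<close> so that the edge with ends
  \<open>i\<close>, \<open>i + 1\<close> goes to edge \<open>s - i\<close>. If \<open>2 * j\<close>
  is congruent to \<open>s\<close>, edge \<open>j\<close> is fixed with its ends exchanged: a
  Moebius cycle of length 1. All other edge cycles have length 2 and are cylindrical because the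
  reflection is an involution.\<close>

lemma sum_reflection:
  fixes a b c \<beta> \<gamma> :: "nat \<Rightarrow> 'b::comm_semiring_1"
  assumes perm: "\<sigma> permutes verts G" and \<sigma>: "\<And>i. \<sigma> (p i) = p (s + 1 - i)"
  shows "(\<Sum>\<mu>\<in>fixed_matchings G \<sigma>. walsh_weight G a b c \<beta> \<gamma> \<sigma> \<mu>) =
    (\<Prod>D\<in>vertex_cycles G \<sigma>. a (card D)) *
    sparse_sum (reflect_rep n s) (range (reflect_rep n s))
      (\<lambda>j. if int n dvd 2 * j - s then c 1 else b 2) (\<lambda>j. if int n dvd 2 * j - s then \<gamma> 1 else \<beta> 2)"
proof -
  let ?\<rho> = "reflect_rep n s"
  let ?cyl = "\<lambda>j. \<not> int n dvd 2 * j - s"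
  let ?len = "\<lambda>j. if int n dvd 2 * j - s then 1 else 2 :: nat"
  have \<sigma>E: "\<sigma> ` E i = E (s - i)" for i by (auto simp: E_def \<sigma> algebra_simps)
  have inv: "\<sigma> (\<sigma> (p i)) = p i" for i by (simp add: \<sigma>)
  note orb = orbit_reflection_eq_image[of E n "(`) \<sigma>" s, OF E_eq_iff \<sigma>E]
  note orb' = orbit_reflection[of "(`) \<sigma>" E s, OF \<sigma>E]
  note card = card_orbit_reflection[of E n "(`) \<sigma>" s, OF E_eq_iff \<sigma>E]
  have "(\<Sum>\<mu>\<in>fixed_matchings G \<sigma>. walsh_weight G a b c \<beta> \<gamma> \<sigma> \<mu>) =
    (\<Prod>D\<in>vertex_cycles G \<sigma>. a (card D)) *
    sparse_sum ?\<rho> (range ?\<rho>) (\<lambda>j. if ?cyl j then b (?len j) else c (?len j))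
      (\<lambda>j. if ?cyl j then \<beta> (?len j) else \<gamma> (?len j))"
  proof (rule sum_fixed_matchings[OF perm orb])
    show "?\<rho> i = ?\<rho> j" if "int n dvd i - j" for i j using that by (simp add: reflect_rep_eq_iff)
    show "cylindrical \<sigma> (orbit ((`) \<sigma>) (E (?\<rho> i)))" if "?cyl (?\<rho> i)" for i
      unfolding cylindrical_def card unfolding orb' using that by (auto simp: E_def inv numeral_2_eq_2)
    show "moebius \<sigma> (orbit ((`) \<sigma>) (E (?\<rho> i)))" if "\<not> ?cyl (?\<rho> i)" for i
    proof -
      let ?j = "?\<rho> i"
      have "int n dvd 2 * ?j - s" using that by simp
      moreover have "(s - ?j) - ?j = - (2 * ?j - s)" "(s + 1 - ?j) - (?j + 1) = - (2 * ?j - s)"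
        by simp_all
      ultimately have swap: "E (s - ?j) = E ?j" "p (s - ?j) = p ?j" "p (s + 1 - ?j) = p (?j + 1)"
        unfolding E_eq_iff p_eq_iff by (simp_all only: dvd_minus_iff)
      have "\<sigma> (p ?j) = p (?j + 1)" "\<sigma> (p (?j + 1)) = p ?j" using swap by (simp_all add: \<sigma>)
      then show ?thesis unfolding moebius_def card unfolding orb' swap using that by (auto simp: E_def)
    qed
  qed (use card reflect_rep_idem in auto)
  also have "(\<lambda>j. if ?cyl j then b (?len j) else c (?len j)) = (\<lambda>j. if int n dvd 2 * j - s then c 1 else b 2)"
    by auto
  also have "(\<lambda>j. if ?cyl j then \<beta> (?len j) else \<gamma> (?len j)) = (\<lambda>j. if int n dvd 2 * j - s then \<gamma> 1 else \<beta> 2)"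
    by auto
  finally show ?thesis .
qed

end

section \<open>Quotients by a reflection\<close>

lemma dvd_iff_end:
  assumes "n > 0" "0 \<le> x" "x \<le> int n"
  shows "int n dvd x \<longleftrightarrow> x = 0 \<or> x = int n"
  using assms by (auto dest: zdvd_imp_le)

lemma not_dvd_odd_int:
  assumes "even n"
  shows "\<not> int n dvd 2 * j - - 1"
proof
  assume "int n dvd 2 * j - - 1"
  moreover have "2 dvd int n" using assms by simp
  ultimately have "2 dvd 2 * j - - 1" by (rule dvd_trans[rotated])
  then show False by presburger
qed

text \<open>Class \<open>0\<close> is a single index with both neighbours in class \<open>1\<close>.
  Only for odd \<open>n\<close> is there a class with two consecutive indices,
  \<open>(n - 1) / 2\<close> and \<open>(n + 1) / 2\<close>, at the far end; for even
  \<open>n\<close> the exceptional set is empty.\<close>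

lemma reflect_rep_0_walk:
  assumes n: "n > 0" and "S \<subseteq> {0..int (n div 2)}"
  shows "(\<forall>i. reflect_rep n 0 i \<in> S \<longrightarrow> reflect_rep n 0 (i + 1) \<notin> S) \<longleftrightarrow>
    S \<inter> {j. 2 * j + 1 = int n} = {} \<and> (\<forall>i. i \<in> S \<longrightarrow> i + 1 \<notin> S)"
proof (rule sparse_walk_iff[OF _ _ _ assms(2)])
  fix i
  have "0 \<le> i mod int n" "i mod int n < int n" using n by simp_all
  then show "reflect_rep n 0 (i + 1) = reflect_rep n 0 i + 1 \<or>
      reflect_rep n 0 i = reflect_rep n 0 (i + 1) + 1 \<or>
      reflect_rep n 0 (i + 1) = reflect_rep n 0 i \<and> reflect_rep n 0 i \<in> {j. 2 * j + 1 = int n}"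
    unfolding reflect_rep_0[OF n] int_mod_succ[OF n] by (auto split: if_splits)
next
  fix j assume "j \<in> {0..int (n div 2)}" "j + 1 \<in> {0..int (n div 2)}"
  then have "0 \<le> j" "2 * j + 2 \<le> int n" by auto
  then show "reflect_rep n 0 j = j \<and> reflect_rep n 0 (j + 1) = j + 1"
    by (simp add: reflect_rep_0[OF n])
next
  fix j assume j: "j \<in> {j. 2 * j + 1 = int n}"
  then have "reflect_rep n 0 j = j"
    using n by (simp add: reflect_rep_0[OF n])
  moreover have "reflect_rep n 0 (j + 1) = j"
    using j n by (cases "j = 0") (auto simp: reflect_rep_0)
  ultimately show "\<exists>i. reflect_rep n 0 i = j \<and> reflect_rep n 0 (i + 1) = j" by blast
qed

text \<open>Both ends of the folded cycle are self-adjacent: \<open>- 1\<close> and \<open>0\<close>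
  lie in one class, and so do \<open>n / 2 - 1\<close> and \<open>n / 2\<close>. These pairs are the
  witnesses.\<close>

lemma reflect_rep_minus_1_walk:
  assumes n: "n > 0" "even n" and "S \<subseteq> {0..int ((n - 1) div 2)}"
  shows "(\<forall>i. reflect_rep n (- 1) i \<in> S \<longrightarrow> reflect_rep n (- 1) (i + 1) \<notin> S) \<longleftrightarrow>
    S \<inter> {0, int (n div 2) - 1} = {} \<and> (\<forall>i. i \<in> S \<longrightarrow> i + 1 \<notin> S)"
proof (rule sparse_walk_iff[OF _ _ _ assms(3)])
  fix i
  obtain m where m: "n = 2 * m" using n(2) by blast
  have "0 \<le> i mod int n" "i mod int n < int n" using n by simp_all
  then show "reflect_rep n (- 1) (i + 1) = reflect_rep n (- 1) i + 1 \<or>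
      reflect_rep n (- 1) i = reflect_rep n (- 1) (i + 1) + 1 \<or>
      reflect_rep n (- 1) (i + 1) = reflect_rep n (- 1) i \<and>
      reflect_rep n (- 1) i \<in> {0, int (n div 2) - 1}"
    unfolding reflect_rep_minus_1[OF n(1)] int_mod_succ[OF n(1)] using m
    by (auto split: if_splits simp: min_def)
next
  fix j assume "j \<in> {0..int ((n - 1) div 2)}" "j + 1 \<in> {0..int ((n - 1) div 2)}"
  then have "0 \<le> j" "2 * j + 2 \<le> int n - 1" using n by auto
  then show "reflect_rep n (- 1) j = j \<and> reflect_rep n (- 1) (j + 1) = j + 1"
    by (simp add: reflect_rep_minus_1[OF n(1)])
next
  obtain m where m: "n = 2 * m" "m > 0" using n by (auto elim: evenE)
  fix j assume "j \<in> {0, int (n div 2) - 1}"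
  then consider "j = 0" | "j = int m - 1" using m by auto
  then show "\<exists>i. reflect_rep n (- 1) i = j \<and> reflect_rep n (- 1) (i + 1) = j"
  proof cases
    case 1
    have "(- 1) mod int n = int n - 1" using n by (simp add: zmod_minus1)
    then show ?thesis using 1 n by (intro exI[of _ "- 1"]) (simp add: reflect_rep_minus_1[OF n(1)])
  next
    case 2
    then show ?thesis using m by (intro exI[of _ j]) (simp add: reflect_rep_minus_1)
  qed
qed

text \<open>The quotient path has a fixed edge at \<open>0\<close> and a self-adjacent class at
  \<open>m\<close>. The latter contributes \<open>\<beta>2\<close>, which is precisely the extra
  factor that the first part of \<open>sparse_sum_path_end\<close> requires when
  \<open>m = 1\<close>.\<close>

lemma sparse_sum_reflect_odd:
  fixes b2 c1 \<beta>2 \<gamma>1 :: "'b::field"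
  assumes "m > 0" and n: "n = 2 * m + 1"
  shows "sparse_sum (reflect_rep n 0) (range (reflect_rep n 0))
      (\<lambda>j. if int n dvd 2 * j - 0 then c1 else b2) (\<lambda>j. if int n dvd 2 * j - 0 then \<gamma>1 else \<beta>2) =
    \<beta>2 * \<gamma>1 * path_U m b2 \<beta>2 + \<beta>2 ^ 2 * c1 * path_U (m - 1) b2 \<beta>2"
proof -
  let ?Y = "\<lambda>j. if int n dvd 2 * j - 0 then c1 else b2"
  let ?Z = "\<lambda>j. if int n dvd 2 * j - 0 then \<gamma>1 else \<beta>2"
  have dvd: "int n dvd 2 * j - 0 \<longleftrightarrow> j = 0" if "0 \<le> j" "j \<le> int m" for j
    using dvd_iff_end[of n "2 * j"] that n by auto
  have "n > 0" using n by simp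
  have J: "range (reflect_rep n 0) = {0..int m}"
    using range_reflect_rep_0[OF \<open>n > 0\<close>] n by simp
  have "sparse_sum (reflect_rep n 0) {0..int m} ?Y ?Z =
      prod ?Z {int m} * sparse_sum (\<lambda>i. i) ({0..int m} - {int m}) ?Y ?Z"
  proof (rule sparse_sum_avoid)
    fix S assume "S \<subseteq> {0..int m}"
    moreover have "{j. 2 * j + 1 = int n} = {int m}" using n by auto
    ultimately show "(\<forall>i. reflect_rep n 0 i \<in> S \<longrightarrow> reflect_rep n 0 (i + 1) \<notin> S) \<longleftrightarrow>
        S \<inter> {int m} = {} \<and> (\<forall>i. i \<in> S \<longrightarrow> i + 1 \<notin> S)"
      using reflect_rep_0_walk[OF \<open>n > 0\<close>, of S] n by simp
  qed auto
  also have "prod ?Z {int m} = \<beta>2" using dvd[of "int m"] assms by simp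
  also have "sparse_sum (\<lambda>i. i) ({0..int m} - {int m}) ?Y ?Z =
      sparse_sum (\<lambda>i. i) {0..0 + int (m - 1)} (\<lambda>j. if j = 0 then c1 else b2) (\<lambda>j. if j = 0 then \<gamma>1 else \<beta>2)"
    by (rule sparse_sum_cong) (use assms(1) dvd in auto)
  also have "\<beta>2 * \<dots> = \<beta>2 * \<gamma>1 * path_U (Suc (m - 1)) b2 \<beta>2 + c1 * \<beta>2 ^ 2 * path_U (m - 1) b2 \<beta>2"
    by (rule sparse_sum_path_end(1))
  finally show ?thesis using assms(1) by (simp add: J mult_ac)
qed

text \<open>Both ends \<open>0\<close> and \<open>m\<close> are fixed edges. Deciding
  \<open>m\<close> and then \<open>0\<close> gives four terms; the two with exactly one fixed edge
  matched coincide, hence the coefficient 2.\<close>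

lemma sparse_sum_reflect_even:
  fixes b2 c1 \<beta>2 \<gamma>1 :: "'b::field"
  assumes "m \<ge> 2" and n: "n = 2 * m"
  shows "sparse_sum (reflect_rep n 0) (range (reflect_rep n 0))
      (\<lambda>j. if int n dvd 2 * j - 0 then c1 else b2) (\<lambda>j. if int n dvd 2 * j - 0 then \<gamma>1 else \<beta>2) =
    \<gamma>1 ^ 2 * path_U m b2 \<beta>2 + 2 * c1 * \<gamma>1 * \<beta>2 * path_U (m - 1) b2 \<beta>2
      + c1 ^ 2 * \<beta>2 ^ 2 * path_U (m - 2) b2 \<beta>2"
proof -
  let ?Y = "\<lambda>j. if int n dvd 2 * j - 0 then c1 else b2"
  let ?Z = "\<lambda>j. if int n dvd 2 * j - 0 then \<gamma>1 else \<beta>2"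
  let ?V = "\<lambda>j::int. if j = 0 then c1 else b2" and ?W = "\<lambda>j::int. if j = 0 then \<gamma>1 else \<beta>2"
  have dvd: "int n dvd 2 * j - 0 \<longleftrightarrow> j = 0 \<or> j = int m" if "0 \<le> j" "j \<le> int m" for j
    using dvd_iff_end[of n "2 * j"] that assms by auto
  have "n > 0" using assms by simp
  have J: "range (reflect_rep n 0) = {0..int m}"
    using range_reflect_rep_0[OF \<open>n > 0\<close>] n by simp
  have "sparse_sum (reflect_rep n 0) {0..int m} ?Y ?Z =
      prod ?Z {} * sparse_sum (\<lambda>i. i) ({0..int m} - {}) ?Y ?Z"
  proof (rule sparse_sum_avoid)
    fix S assume "S \<subseteq> {0..int m}"
    moreover have "{j. 2 * j + 1 = int n} = {}" using n by auto presburger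
    ultimately show "(\<forall>i. reflect_rep n 0 i \<in> S \<longrightarrow> reflect_rep n 0 (i + 1) \<notin> S) \<longleftrightarrow>
        S \<inter> {} = {} \<and> (\<forall>i. i \<in> S \<longrightarrow> i + 1 \<notin> S)"
      using reflect_rep_0_walk[OF \<open>n > 0\<close>, of S] n by simp
  qed auto
  also have "\<dots> = sparse_sum (\<lambda>i. i) (insert (int m) {0..<int m}) ?Y ?Z"
    by (auto intro!: sparse_sum_cong)
  also have "\<dots> = ?Z (int m) * sparse_sum (\<lambda>i. i) {0..<int m} ?Y ?Z +
      ?Y (int m) * (prod ?Z ({0..<int m} \<inter> {int m - 1, int m + 1}) *
        sparse_sum (\<lambda>i. i) ({0..<int m} - {int m - 1, int m + 1}) ?Y ?Z)"
    by (rule sparse_sum_insert) auto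
  also have "?Z (int m) = \<gamma>1" using dvd[of "int m"] by simp
  also have "?Y (int m) = c1" using dvd[of "int m"] by simp
  also have "sparse_sum (\<lambda>i. i) {0..<int m} ?Y ?Z = sparse_sum (\<lambda>i. i) {0..0 + int (m - 1)} ?V ?W"
    by (rule sparse_sum_cong) (use assms(1) dvd in auto)
  also have "\<dots> = \<gamma>1 * path_U (Suc (m - 1)) b2 \<beta>2 + c1 * \<beta>2 * path_U (m - 1) b2 \<beta>2"
    using assms(1) by (intro sparse_sum_path_end(2)) simp
  also have "{0..<int m} \<inter> {int m - 1, int m + 1} = {int m - 1}" using assms(1) by auto
  also have "prod ?Z {int m - 1} = \<beta>2" using dvd[of "int m - 1"] assms(1) by simp
  also have "sparse_sum (\<lambda>i. i) ({0..<int m} - {int m - 1, int m + 1}) ?Y ?Z =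
      sparse_sum (\<lambda>i. i) {0..0 + int (m - 2)} ?V ?W"
    by (rule sparse_sum_cong) (use assms(1) dvd in auto)
  \<comment> \<open>The factor \<open>\<beta>2\<close> comes from \<open>m - 1\<close>, which is
    excluded once \<open>m\<close> is matched. It is needed for \<open>m = 2\<close>, where
    \<open>path_U 0\<close> appears.\<close>
  also have "\<beta>2 * \<dots> = \<beta>2 * \<gamma>1 * path_U (Suc (m - 2)) b2 \<beta>2 + c1 * \<beta>2 ^ 2 * path_U (m - 2) b2 \<beta>2"
    by (rule sparse_sum_path_end(1))
  also have "Suc (m - 2) = m - 1" using assms(1) by simp
  also have "Suc (m - 1) = m" using assms(1) by simp
  finally show ?thesis by (simp add: J algebra_simps power2_eq_square)
qed

text \<open>The self-adjacent ends contribute \<open>\<beta>2\<close> each. Between them remain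
  \<open>m - 2\<close> edges, a path with \<open>m - 1\<close> vertices; as no edge is fixed,
  \<open>c1\<close> and \<open>\<gamma>1\<close> disappear.\<close>

lemma sparse_sum_reflect_even_vertices:
  fixes b2 c1 \<beta>2 \<gamma>1 :: "'b::field"
  assumes "m \<ge> 2" and n: "n = 2 * m"
  shows "sparse_sum (reflect_rep n (- 1)) (range (reflect_rep n (- 1)))
      (\<lambda>j. if int n dvd 2 * j - - 1 then c1 else b2) (\<lambda>j. if int n dvd 2 * j - - 1 then \<gamma>1 else \<beta>2) =
    \<beta>2 ^ 2 * path_U (m - 1) b2 \<beta>2"
proof -
  let ?Y = "\<lambda>j. if int n dvd 2 * j - - 1 then c1 else b2"
  let ?Z = "\<lambda>j. if int n dvd 2 * j - - 1 then \<gamma>1 else \<beta>2"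
  have ndvd: "\<not> int n dvd 2 * j - - 1" for j
    using n by (intro not_dvd_odd_int) simp
  have "n > 0" "even n" using assms by simp_all
  have J: "range (reflect_rep n (- 1)) = {0..int (m - 1)}"
    using range_reflect_rep_minus_1[OF \<open>n > 0\<close>] assms by auto
  have "sparse_sum (reflect_rep n (- 1)) {0..int (m - 1)} ?Y ?Z =
      prod ?Z {0, int m - 1} * sparse_sum (\<lambda>i. i) ({0..int (m - 1)} - {0, int m - 1}) ?Y ?Z"
  proof (rule sparse_sum_avoid)
    fix S assume "S \<subseteq> {0..int (m - 1)}"
    then show "(\<forall>i. reflect_rep n (- 1) i \<in> S \<longrightarrow> reflect_rep n (- 1) (i + 1) \<notin> S) \<longleftrightarrow>
        S \<inter> {0, int m - 1} = {} \<and> (\<forall>i. i \<in> S \<longrightarrow> i + 1 \<notin> S)"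
      using reflect_rep_minus_1_walk[OF \<open>n > 0\<close> \<open>even n\<close>, of S] J n
        range_reflect_rep_minus_1[OF \<open>n > 0\<close>] by simp
  qed (use assms in auto)
  also have "prod ?Z {0, int m - 1} = \<beta>2 ^ 2"
    using assms(1) by (simp only: ndvd if_False) (simp add: power2_eq_square)
  also have "sparse_sum (\<lambda>i. i) ({0..int (m - 1)} - {0, int m - 1}) ?Y ?Z =
      sparse_sum (\<lambda>i. i) {1..<1 + int (m - 2)} (\<lambda>_. b2) (\<lambda>_. \<beta>2)"
    by (rule sparse_sum_cong) (use assms(1) ndvd in auto)
  also have "\<dots> = path_U (Suc (m - 2)) b2 \<beta>2" by (rule path_U_eq_sparse_sum[symmetric])
  also have "Suc (m - 2) = m - 1" using assms(1) by simp
  finally show ?thesis by (simp only: J)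
qed

text \<open>Here the folding acts on vertices: the fixed ones are \<open>0\<close> and
  \<open>m\<close>, the others form pairs.\<close>

lemma prod_reflect_0_even:
  fixes a :: "nat \<Rightarrow> 'b::comm_semiring_1"
  assumes "m > 0" and n: "n = 2 * m"
  shows "(\<Prod>j\<in>range (reflect_rep n 0). a (if int n dvd 2 * j - 0 then 1 else 2)) = a 1 ^ 2 * a 2 ^ (m - 1)"
proof -
  let ?a = "\<lambda>j. a (if int n dvd 2 * j - 0 then 1 else 2)"
  have "n > 0" using assms by simp
  have dvd: "int n dvd 2 * j - 0 \<longleftrightarrow> j = 0 \<or> j = int m" if "0 \<le> j" "j \<le> int m" for j
    using dvd_iff_end[of n "2 * j"] that assms by auto
  have "range (reflect_rep n 0) = insert 0 (insert (int m) {1..<int m})"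
    using range_reflect_rep_0[OF \<open>n > 0\<close>] assms by auto
  then have "prod ?a (range (reflect_rep n 0)) = ?a 0 * (?a (int m) * prod ?a {1..<int m})"
    using assms(1) by (simp only:) (subst prod.insert; auto)+
  also have "prod ?a {1..<int m} = (\<Prod>j\<in>{1..<int m}. a 2)"
    by (rule prod.cong) (use dvd in auto)
  also have "\<dots> = a 2 ^ (m - 1)" using assms(1) by (simp add: nat_diff_distrib)
  finally show ?thesis using dvd[of 0] dvd[of "int m"] by (simp add: power2_eq_square mult_ac)
qed

lemma prod_reflect_minus_1:
  fixes a :: "nat \<Rightarrow> 'b::comm_semiring_1"
  shows "n = 2 * m \<Longrightarrow> m > 0 \<Longrightarrow>
      (\<Prod>j\<in>range (reflect_rep n (- 1)). a (if int n dvd 2 * j - - 1 then 1 else 2)) = a 2 ^ m"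
    and "n = 2 * m + 1 \<Longrightarrow>
      (\<Prod>j\<in>range (reflect_rep n (- 1)). a (if int n dvd 2 * j - - 1 then 1 else 2)) = a 1 * a 2 ^ m"
proof -
  let ?a = "\<lambda>j. a (if int n dvd 2 * j - - 1 then 1 else 2)"
  assume n: "n = 2 * m" "m > 0"
  have ndvd: "\<not> int n dvd 2 * j - - 1" for j
    using n by (intro not_dvd_odd_int) simp
  have "range (reflect_rep n (- 1)) = {0..<int m}"
    using range_reflect_rep_minus_1[of n] n by auto
  then show "prod ?a (range (reflect_rep n (- 1))) = a 2 ^ m" by (simp only: ndvd if_False) simp
next
  let ?a = "\<lambda>j. a (if int n dvd 2 * j - - 1 then 1 else 2)"
  assume n: "n = 2 * m + 1"
  have dvd: "int n dvd 2 * j - - 1 \<longleftrightarrow> j = int m" if "0 \<le> j" "j \<le> int m" for j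
    using dvd_iff_end[of n "2 * j + 1"] that n by auto
  have "range (reflect_rep n (- 1)) = insert (int m) {0..<int m}"
    using range_reflect_rep_minus_1[of n] n by auto
  then have "prod ?a (range (reflect_rep n (- 1))) = ?a (int m) * prod ?a {0..<int m}" by simp
  also have "prod ?a {0..<int m} = (\<Prod>j\<in>{0..<int m}. a 2)"
    by (rule prod.cong) (use dvd in auto)
  also have "?a (int m) = a 1" using dvd[of "int m"] by simp
  finally show "prod ?a (range (reflect_rep n (- 1))) = a 1 * a 2 ^ m" by simp
qed

section \<open>The automorphism group of a cycle\<close>

context cyclic_labelling
begin

text \<open>The labelling \<open>p\<close> is periodic, so \<open>inv p x\<close> is merely some
  index of \<open>x\<close>; \<open>dihedral_p\<close> shows that the choice does not matter. Off
  the graph the map is the identity, as \<open>automorphisms\<close> demands.\<close>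

definition dihedral :: "int \<Rightarrow> int \<Rightarrow> 'v \<Rightarrow> 'v" where
  "dihedral \<epsilon> s x = (if x \<in> range p then p (\<epsilon> * inv p x + s) else x)"

lemma dihedral_p: "dihedral \<epsilon> s (p i) = p (\<epsilon> * i + s)"
proof -
  have "p (inv p (p i)) = p i" by (rule f_inv_into_f) simp
  then have "int n dvd \<epsilon> * (inv p (p i) - i)" by (simp only: p_eq_iff dvd_mult)
  also have "\<epsilon> * (inv p (p i) - i) = (\<epsilon> * inv p (p i) + s) - (\<epsilon> * i + s)"
    by (simp add: algebra_simps)
  finally show ?thesis unfolding dihedral_def by (simp only: p_eq_iff rangeI if_True)
qed

lemma dihedral_permutes:
  assumes "\<epsilon> \<in> {1, - 1}"
  shows "dihedral \<epsilon> s permutes verts G"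
proof -
  have "inj_on (dihedral \<epsilon> s) (verts G)"
  proof (rule inj_onI)
    fix x y assume "x \<in> verts G" "y \<in> verts G" "dihedral \<epsilon> s x = dihedral \<epsilon> s y"
    moreover obtain i j where "x = p i" "y = p j" using calculation by (auto simp: verts_eq)
    ultimately have "int n dvd (\<epsilon> * i + s) - (\<epsilon> * j + s)" by (simp add: dihedral_p p_eq_iff)
    also have "(\<epsilon> * i + s) - (\<epsilon> * j + s) = \<epsilon> * (i - j)" by (simp add: algebra_simps)
    finally show "x = y" using assms \<open>x = p i\<close> \<open>y = p j\<close> by (auto simp: p_eq_iff dvd_diff_commute)
  qed
  moreover have "dihedral \<epsilon> s ` verts G \<subseteq> verts G" by (auto simp: verts_eq dihedral_p)
  ultimately have "bij_betw (dihedral \<epsilon> s) (verts G) (verts G)"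
    using finite_verts by (simp add: bij_betw_def endo_inj_surj)
  then show ?thesis by (rule bij_imp_permutes) (simp add: dihedral_def verts_eq)
qed

lemma edge_iff: "{p i, p j} \<in> edges G \<longleftrightarrow> p j = p (i + 1) \<or> p j = p (i - 1)"
proof
  assume "{p i, p j} \<in> edges G"
  then obtain k where "{p i, p j} = {p k, p (k + 1)}" by (auto simp: edges_eq)
  then have "p i = p k \<and> p j = p (k + 1) \<or> p i = p (k + 1) \<and> p j = p k"
    by (auto simp: doubleton_eq_iff)
  then show "p j = p (i + 1) \<or> p j = p (i - 1)"
  proof
    assume "p i = p k \<and> p j = p (k + 1)"
    then have "int n dvd (i - k)" "p j = p (k + 1)" by (simp_all add: p_eq_iff)
    then have "int n dvd (k + 1) - (i + 1)" by (simp add: dvd_diff_commute)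
    then have "p (k + 1) = p (i + 1)" by (simp only: p_eq_iff)
    then show ?thesis using \<open>p j = p (k + 1)\<close> by simp
  next
    assume *: "p i = p (k + 1) \<and> p j = p k"
    then have "int n dvd (i - (k + 1))" by (simp only: p_eq_iff)
    then have "int n dvd - (i - (k + 1))" by (simp only: dvd_minus_iff)
    also have "- (i - (k + 1)) = k - (i - 1)" by simp
    finally have "p k = p (i - 1)" by (simp only: p_eq_iff)
    then show ?thesis using * by simp
  qed
next
  assume "p j = p (i + 1) \<or> p j = p (i - 1)"
  then have "{p i, p j} = {p i, p (i + 1)} \<or> {p i, p j} = {p (i - 1), p (i - 1 + 1)}"
    by (auto simp: insert_commute)
  then show "{p i, p j} \<in> edges G" unfolding edges_eq by blast
qed

lemma dihedral_automorphism:
  assumes "\<epsilon> \<in> {1, - 1}"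
  shows "dihedral \<epsilon> s \<in> automorphisms G"
proof -
  have "p (\<epsilon> * i + s) = p (\<epsilon> * j + s) \<longleftrightarrow> p i = p j" for i j
  proof -
    have "(\<epsilon> * i + s) - (\<epsilon> * j + s) = \<epsilon> * (i - j)" by (simp add: algebra_simps)
    then show ?thesis using assms unfolding p_eq_iff by (auto simp: dvd_diff_commute)
  qed
  note inj = this
  have "{p i, p j} \<in> edges G \<longleftrightarrow> {dihedral \<epsilon> s (p i), dihedral \<epsilon> s (p j)} \<in> edges G" for i j
  proof -
    have "{dihedral \<epsilon> s (p i), dihedral \<epsilon> s (p j)} \<in> edges G \<longleftrightarrow>
        p (\<epsilon> * j + s) = p (\<epsilon> * i + s + 1) \<or> p (\<epsilon> * j + s) = p (\<epsilon> * i + s - 1)"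
      unfolding dihedral_p by (rule edge_iff)
    also have "\<dots> \<longleftrightarrow> p (\<epsilon> * j + s) = p (\<epsilon> * (i + 1) + s) \<or> p (\<epsilon> * j + s) = p (\<epsilon> * (i - 1) + s)"
      using assms by (auto simp: algebra_simps)
    finally show ?thesis unfolding inj edge_iff[symmetric] by simp
  qed
  then show ?thesis
    using dihedral_permutes[OF assms] unfolding automorphisms_def verts_eq by blast
qed

text \<open>The image of \<open>p 0\<close> gives \<open>s\<close> and that of its neighbour
  \<open>p 1\<close> gives the direction \<open>\<epsilon>\<close>. From there on adjacency and
  injectivity leave no choice, by induction on two consecutive vertices.\<close>

lemma automorphism_dihedral:
  assumes "\<sigma> \<in> automorphisms G"
  shows "\<exists>\<epsilon>\<in>{1, - 1}. \<exists>s\<in>{1..int n}. \<sigma> = dihedral \<epsilon> s"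
proof -
  have perm: "\<sigma> permutes verts G" using assms by (simp add: automorphisms_def)
  have range: "\<exists>j. \<sigma> (p i) = p j" for i
    using permutes_in_image[OF perm, of "p i"] by (auto simp: verts_eq)
  have inj: "\<sigma> x = \<sigma> y \<longleftrightarrow> x = y" for x y using permutes_inj[OF perm] by (auto dest: injD)
  have adj: "\<sigma> (p (i + 1)) = p (j + 1) \<or> \<sigma> (p (i + 1)) = p (j - 1)" if ij: "\<sigma> (p i) = p j" for i j
  proof -
    obtain k where k: "\<sigma> (p (i + 1)) = p k" using range by blast
    have "{p i, p (i + 1)} \<in> edges G" by (simp add: edge_iff)
    then have "{\<sigma> (p i), \<sigma> (p (i + 1))} \<in> edges G"
      using assms unfolding automorphisms_def verts_eq by blast
    then show ?thesis unfolding ij k edge_iff .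
  qed
  obtain t where t: "\<sigma> (p 0) = p t" using range by blast
  \<comment> \<open>The representative of \<open>t\<close> modulo \<open>n\<close> in
    \<open>{1..int n}\<close>, not in \<open>{0..<int n}\<close>.\<close>
  define s where "s = (t - 1) mod int n + 1"
  have "0 \<le> (t - 1) mod int n" "(t - 1) mod int n < int n" using n_pos by simp_all
  then have s: "s \<in> {1..int n}" unfolding s_def atLeastAtMost_iff by linarith
  have "int n dvd s - t"
    unfolding s_def mod_eq_dvd_iff[symmetric] by (metis diff_add_cancel mod_add_left_eq)
  then have s0: "\<sigma> (p 0) = p s" using t by (metis p_eq_iff)
  have "\<sigma> (p 1) = p (s + 1) \<or> \<sigma> (p 1) = p (s + - 1)" using adj[OF s0] by simp
  then obtain \<epsilon> where \<epsilon>: "\<epsilon> \<in> {1, - 1}" "\<sigma> (p 1) = p (s + \<epsilon>)" by blast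
  have nat: "\<sigma> (p (int k)) = p (\<epsilon> * int k + s) \<and> \<sigma> (p (int k + 1)) = p (\<epsilon> * (int k + 1) + s)" for k
  proof (induction k)
    case 0
    then show ?case using s0 \<epsilon>(2) by (simp add: add.commute)
  next
    case (Suc k)
    \<comment> \<open>The image of the next vertex cannot turn back, because \<open>n\<close> does
      not divide 2.\<close>
    have "p (int k + 2) \<noteq> p (int k)" using not_dvd_small[of 2] by (simp add: p_eq_iff)
    then have "\<sigma> (p (int k + 1 + 1)) \<noteq> p (\<epsilon> * int k + s)" using Suc inj by (metis add.assoc one_add_one)
    moreover have "\<sigma> (p (int k + 1 + 1)) = p (\<epsilon> * (int k + 1) + s + 1) \<or>
        \<sigma> (p (int k + 1 + 1)) = p (\<epsilon> * (int k + 1) + s - 1)"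
      by (rule adj) (use Suc in simp)
    ultimately have "\<sigma> (p (int k + 1 + 1)) = p (\<epsilon> * (int k + 1 + 1) + s)"
      using \<epsilon>(1) by (auto simp: algebra_simps)
    then show ?case using Suc by (simp add: add.commute)
  qed
  have "\<sigma> x = dihedral \<epsilon> s x" for x
  proof (cases "x \<in> range p")
    case True
    then obtain i where i: "x = p i" by blast
    have "int n dvd i - int (nat (i mod int n))" using n_pos by (simp add: minus_mod_eq_mult_div)
    then have "x = p (int (nat (i mod int n)))" unfolding i p_eq_iff .
    then show ?thesis using nat by (metis dihedral_p)
  next
    case False
    then show ?thesis using permutes_not_in[OF perm] by (simp add: dihedral_def verts_eq)
  qed
  then show ?thesis using \<epsilon> s by blast
qed

text \<open>Evaluation at index 0 determines \<open>s\<close>; evaluation at index 1 then determines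
  \<open>\<epsilon>\<close>, since 1 and \<open>- 1\<close> differ modulo
  \<open>n \<ge> 3\<close>.\<close>

lemma dihedral_inj: "inj_on (\<lambda>(\<epsilon>, s). dihedral \<epsilon> s) ({1, - 1} \<times> {1..int n})"
proof (rule inj_onI, clarify)
  fix \<epsilon> \<epsilon>' s s' :: int
  assume mem: "\<epsilon> \<in> {1, - 1}" "\<epsilon>' \<in> {1, - 1}" "s \<in> {1..int n}" "s' \<in> {1..int n}"
    and eq: "dihedral \<epsilon> s = dihedral \<epsilon>' s'"
  have *: "int n dvd (\<epsilon> * i + s) - (\<epsilon>' * i + s')" for i
    using fun_cong[OF eq, of "p i"] by (simp only: dihedral_p p_eq_iff)
  have "int n dvd s - s'" using *[of 0] by simp
  have "s = s'"
  proof (rule ccontr)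
    assume "s \<noteq> s'"
    then have "int n \<le> \<bar>s - s'\<bar>" using dvd_imp_le_int[OF _ \<open>int n dvd s - s'\<close>] by simp
    then show False using mem by auto
  qed
  then have "int n dvd \<epsilon> - \<epsilon>'" using *[of 1] by simp
  then show "\<epsilon> = \<epsilon>' \<and> s = s'" using \<open>s = s'\<close> mem not_dvd_small[of 2] not_dvd_small[of "- 2"] by auto
qed

lemma automorphisms_eq: "automorphisms G = (\<lambda>(\<epsilon>, s). dihedral \<epsilon> s) ` ({1, - 1} \<times> {1..int n})"
  using automorphism_dihedral dihedral_automorphism by fastforce

lemma card_automorphisms: "card (automorphisms G) = 2 * n"
  unfolding automorphisms_eq card_image[OF dihedral_inj] by (simp add: card_cartesian_product)

text \<open>Shifts run over \<open>{0<..n}\<close>, the range in which gcds with \<open>n\<close>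
  are counted by the totient; the identity is the shift by \<open>n\<close>.\<close>

lemma sum_automorphisms:
  fixes F :: "_ \<Rightarrow> 'b::comm_monoid_add"
  shows "(\<Sum>\<sigma>\<in>automorphisms G. F \<sigma>) =
    (\<Sum>r\<in>{0<..n}. F (dihedral 1 (int r))) + (\<Sum>s\<in>{0<..n}. F (dihedral (- 1) (int s)))"
proof -
  have img: "(\<Sum>s\<in>{1..int n}. h s) = (\<Sum>r\<in>{0<..n}. h (int r))" for h :: "int \<Rightarrow> 'b"
    by (rule sum.reindex_bij_witness[of _ int nat]) auto
  have "(\<Sum>\<sigma>\<in>automorphisms G. F \<sigma>) = (\<Sum>(\<epsilon>, s)\<in>{1, - 1} \<times> {1..int n}. F (dihedral \<epsilon> s))"
    unfolding automorphisms_eq sum.reindex[OF dihedral_inj] by (simp add: case_prod_unfold)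
  also have "\<dots> = (\<Sum>\<epsilon>\<in>{1, - 1}. \<Sum>s\<in>{1..int n}. F (dihedral \<epsilon> s))"
    by (rule sum.cartesian_product[symmetric])
  finally show ?thesis by (simp add: img)
qed

end

section \<open>The Walsh series\<close>

context cyclic_labelling
begin

lemma sum_reflection_through_edge:
  fixes a b c \<beta> \<gamma> :: "nat \<Rightarrow> 'b::field"
  assumes perm: "\<sigma> permutes verts G" and \<sigma>: "\<And>i. \<sigma> (p i) = p (1 - i)"
  shows "n = 2 * m + 1 \<Longrightarrow>
      (\<Sum>\<mu>\<in>fixed_matchings G \<sigma>. walsh_weight G a b c \<beta> \<gamma> \<sigma> \<mu>) =
      a 1 * a 2 ^ m * (\<beta> 2 * \<gamma> 1 * path_U m (b 2) (\<beta> 2) + \<beta> 2 ^ 2 * c 1 * path_U (m - 1) (b 2) (\<beta> 2))"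
    and "n = 2 * m \<Longrightarrow>
      (\<Sum>\<mu>\<in>fixed_matchings G \<sigma>. walsh_weight G a b c \<beta> \<gamma> \<sigma> \<mu>) =
      a 2 ^ m * (\<gamma> 1 ^ 2 * path_U m (b 2) (\<beta> 2) + 2 * c 1 * \<gamma> 1 * \<beta> 2 * path_U (m - 1) (b 2) (\<beta> 2)
        + c 1 ^ 2 * \<beta> 2 ^ 2 * path_U (m - 2) (b 2) (\<beta> 2))"
proof -
  \<comment> \<open>For the edges the constant is 0, for the vertices it is 1. Relabelling the
    vertices by one step turns \<open>1 - i\<close> into \<open>- 1 - i\<close>, so that the vertex
    product is the one already computed for \<open>reflect_rep n (- 1)\<close>.\<close>
  interpret shifted: cyclic_labelling G n "\<lambda>i. p (i + 1)" by (rule cyclic_labelling_shift)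
  have "\<sigma> (p (i + 1)) = p ((- 1 - i) + 1)" for i by (simp add: \<sigma>)
  note V = shifted.vertex_cycles_reflection[of \<sigma> "- 1", OF this]
  have "\<sigma> (p i) = p (0 + 1 - i)" for i by (simp add: \<sigma>)
  note W = sum_reflection[OF perm this, unfolded V]
  {
    assume n: "n = 2 * m + 1"
    then have "m > 0" using n_ge_3 by simp
    show "(\<Sum>\<mu>\<in>fixed_matchings G \<sigma>. walsh_weight G a b c \<beta> \<gamma> \<sigma> \<mu>) =
      a 1 * a 2 ^ m * (\<beta> 2 * \<gamma> 1 * path_U m (b 2) (\<beta> 2) + \<beta> 2 ^ 2 * c 1 * path_U (m - 1) (b 2) (\<beta> 2))"
      by (simp only: W prod_reflect_minus_1(2)[OF n] sparse_sum_reflect_odd[OF \<open>m > 0\<close> n])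
  next
    assume n: "n = 2 * m"
    then have "m \<ge> 2" "m > 0" using n_ge_3 by simp_all
    show "(\<Sum>\<mu>\<in>fixed_matchings G \<sigma>. walsh_weight G a b c \<beta> \<gamma> \<sigma> \<mu>) =
      a 2 ^ m * (\<gamma> 1 ^ 2 * path_U m (b 2) (\<beta> 2) + 2 * c 1 * \<gamma> 1 * \<beta> 2 * path_U (m - 1) (b 2) (\<beta> 2)
        + c 1 ^ 2 * \<beta> 2 ^ 2 * path_U (m - 2) (b 2) (\<beta> 2))"
      by (simp only: W prod_reflect_minus_1(1)[OF n \<open>m > 0\<close>] sparse_sum_reflect_even[OF \<open>m \<ge> 2\<close> n])
  }
qed

lemma sum_reflection_through_vertices:
  fixes a b c \<beta> \<gamma> :: "nat \<Rightarrow> 'b::field"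
  assumes perm: "\<sigma> permutes verts G" and \<sigma>: "\<And>i. \<sigma> (p i) = p (- i)" and n: "n = 2 * m"
  shows "(\<Sum>\<mu>\<in>fixed_matchings G \<sigma>. walsh_weight G a b c \<beta> \<gamma> \<sigma> \<mu>) =
    a 1 ^ 2 * a 2 ^ (m - 1) * \<beta> 2 ^ 2 * path_U (m - 1) (b 2) (\<beta> 2)"
proof -
  have "m \<ge> 2" "m > 0" using n n_ge_3 by simp_all
  have V: "\<sigma> (p i) = p (0 - i)" and W: "\<sigma> (p i) = p (- 1 + 1 - i)" for i by (simp_all add: \<sigma>)
  show ?thesis
    by (simp only: sum_reflection[OF perm W] vertex_cycles_reflection[of \<sigma> 0, OF V] mult.assoc
        prod_reflect_0_even[OF \<open>m > 0\<close> n] sparse_sum_reflect_even_vertices[OF \<open>m \<ge> 2\<close> n])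
qed

text \<open>For odd \<open>n\<close> every reflection fixes an edge: 2 is invertible modulo
  \<open>n\<close>, so a shift \<open>t\<close> with \<open>2 * t\<close> congruent to
  \<open>s - 1\<close> exists for each \<open>s\<close>. The sum is therefore the same for all
  reflections.\<close>

lemma sum_reflection_odd:
  fixes a b c \<beta> \<gamma> :: "nat \<Rightarrow> 'b::field"
  assumes n: "n = 2 * m + 1"
  shows "(\<Sum>\<mu>\<in>fixed_matchings G (dihedral (- 1) s). walsh_weight G a b c \<beta> \<gamma> (dihedral (- 1) s) \<mu>) =
    a 1 * a 2 ^ m * (\<beta> 2 * \<gamma> 1 * path_U m (b 2) (\<beta> 2) + \<beta> 2 ^ 2 * c 1 * path_U (m - 1) (b 2) (\<beta> 2))"
proof -
  \<comment> \<open>\<open>m + 1\<close> is the inverse of 2 modulo \<open>n\<close>.\<close>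
  define t where "t = (s - 1) * (int m + 1)"
  interpret shifted: cyclic_labelling G n "\<lambda>i. p (i + t)" by (rule cyclic_labelling_shift)
  have "dihedral (- 1) s (p (i + t)) = p (1 - i + t)" for i
  proof -
    have "(- 1 * (i + t) + s) - (1 - i + t) = int n * (1 - s)"
      by (simp add: t_def n algebra_simps)
    then show ?thesis unfolding dihedral_p p_eq_iff by simp
  qed
  moreover have "dihedral (- 1) s permutes verts G" by (rule dihedral_permutes) simp
  ultimately show ?thesis using n by (intro shifted.sum_reflection_through_edge(1))
qed

text \<open>The centre of the reflection is \<open>s / 2\<close>: a vertex for even
  \<open>s\<close>, the middle of an edge for odd \<open>s\<close>. Shifting the origin by
  \<open>s div 2\<close> gives the normal form in both cases.\<close>

lemma sum_reflection_even:
  fixes a b c \<beta> \<gamma> :: "nat \<Rightarrow> 'b::field"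
  assumes n: "n = 2 * m"
  shows "(\<Sum>\<mu>\<in>fixed_matchings G (dihedral (- 1) s). walsh_weight G a b c \<beta> \<gamma> (dihedral (- 1) s) \<mu>) =
    (if even s then a 1 ^ 2 * a 2 ^ (m - 1) * \<beta> 2 ^ 2 * path_U (m - 1) (b 2) (\<beta> 2)
     else a 2 ^ m * (\<gamma> 1 ^ 2 * path_U m (b 2) (\<beta> 2) + 2 * c 1 * \<gamma> 1 * \<beta> 2 * path_U (m - 1) (b 2) (\<beta> 2)
        + c 1 ^ 2 * \<beta> 2 ^ 2 * path_U (m - 2) (b 2) (\<beta> 2)))"
proof -
  interpret shifted: cyclic_labelling G n "\<lambda>i. p (i + s div 2)" by (rule cyclic_labelling_shift)
  have perm: "dihedral (- 1) s permutes verts G" by (rule dihedral_permutes) simp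
  show ?thesis
  proof (cases "even s")
    case True
    then have "dihedral (- 1) s (p (i + s div 2)) = p (- i + s div 2)" for i
      unfolding dihedral_p by (auto elim!: evenE)
    from shifted.sum_reflection_through_vertices[OF perm this n] show ?thesis using True by simp
  next
    case False
    then have "dihedral (- 1) s (p (i + s div 2)) = p (1 - i + s div 2)" for i
      unfolding dihedral_p by (auto elim!: oddE simp: algebra_simps)
    from shifted.sum_reflection_through_edge(2)[OF perm this n] show ?thesis using False by simp
  qed
qed

end

text \<open>The shifts \<open>r\<close> are grouped by \<open>d = gcd r n\<close>; there are
  \<open>totient (n div d)\<close> of them in each group.\<close>

lemma sum_gcd_eq_sum_totient:
  fixes f :: "nat \<Rightarrow> 'b::comm_semiring_1"
  assumes "n > 0"
  shows "(\<Sum>r\<in>{0<..n}. f (gcd r n)) = (\<Sum>d | d dvd n. of_nat (totient (n div d)) * f d)"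
proof -
  have "(\<Sum>r\<in>{0<..n}. f (gcd r n)) = (\<Sum>d | d dvd n. \<Sum>r\<in>{r \<in> {0<..n}. gcd r n = d}. f (gcd r n))"
    using assms by (intro sum.group[symmetric]) auto
  also have "\<dots> = (\<Sum>d | d dvd n. of_nat (totient (n div d)) * f d)"
    using assms by (intro sum.cong refl) (simp flip: card_gcd_eq_totient)
  finally show ?thesis .
qed

lemma sum_if_even:
  fixes x y :: "'b::comm_semiring_1"
  shows "(\<Sum>s\<in>{0<..2 * m}. if even s then x else y) = of_nat m * (x + y)"
proof (induction m)
  case (Suc m)
  have "{0<..2 * Suc m} = insert (2 * m + 2) (insert (2 * m + 1) {0<..2 * m})" by auto
  then show ?case using Suc by (simp add: algebra_simps)
qed simp

theorem theorem5:
  fixes n :: nat and a b c \<beta> \<gamma> :: "nat \<Rightarrow> 'a::field_char_0"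
  assumes "n \<ge> 3"
  shows
    "(odd n \<longrightarrow>
       walsh_series (cycle_graph n) a b c \<beta> \<gamma> =
         1 / (2 * of_nat n) *
           (\<Sum>d | d dvd n. of_nat (totient (n div d)) * a (n div d) ^ d *
              cycle_T d (b (n div d)) (\<beta> (n div d)))
         + 1 / 2 * a 1 * a 2 ^ ((n - 1) div 2) *
           (\<beta> 2 * \<gamma> 1 * path_U ((n - 1) div 2) (b 2) (\<beta> 2)
            + \<beta> 2 ^ 2 * c 1 * path_U ((n - 3) div 2) (b 2) (\<beta> 2)))
     \<and>
     (even n \<longrightarrow>
       walsh_series (cycle_graph n) a b c \<beta> \<gamma> =
         1 / (2 * of_nat n) *
           (\<Sum>d | d dvd n. of_nat (totient (n div d)) * a (n div d) ^ d *
              cycle_T d (b (n div d)) (\<beta> (n div d)))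
         + 1 / 4 *
           (a 1 ^ 2 * a 2 ^ ((n - 2) div 2) * \<beta> 2 ^ 2 * path_U ((n - 2) div 2) (b 2) (\<beta> 2)
            + a 2 ^ (n div 2) *
              (\<gamma> 1 ^ 2 * path_U (n div 2) (b 2) (\<beta> 2)
               + 2 * c 1 * \<gamma> 1 * \<beta> 2 * path_U ((n - 2) div 2) (b 2) (\<beta> 2)
               + c 1 ^ 2 * \<beta> 2 ^ 2 * path_U ((n - 4) div 2) (b 2) (\<beta> 2))))"
proof -
  interpret cyclic_labelling "cycle_graph n" n "\<lambda>i. nat (i mod int n) + 1"
    by (rule cyclic_labelling_cycle_graph[OF assms])
  let ?F = "\<lambda>\<sigma>. \<Sum>\<mu>\<in>fixed_matchings (cycle_graph n) \<sigma>. walsh_weight (cycle_graph n) a b c \<beta> \<gamma> \<sigma> \<mu>"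
  let ?R = "\<Sum>d | d dvd n. of_nat (totient (n div d)) * a (n div d) ^ d *
    cycle_T d (b (n div d)) (\<beta> (n div d))"
  have rot: "?F (dihedral 1 (int r)) = a (n div gcd r n) ^ gcd r n *
      cycle_T (gcd r n) (b (n div gcd r n)) (\<beta> (n div gcd r n))" for r
    by (rule sum_rotation[OF dihedral_permutes _ refl]) (simp_all only: dihedral_p mult_1 insertI1)
  have "(\<Sum>r\<in>{0<..n}. ?F (dihedral 1 (int r))) = ?R"
    unfolding rot by (subst sum_gcd_eq_sum_totient) (simp_all add: n_pos mult.assoc)
  then have series: "walsh_series (cycle_graph n) a b c \<beta> \<gamma> = 1 / (2 * of_nat n) * ?R +
      1 / (2 * of_nat n) * (\<Sum>s\<in>{0<..n}. ?F (dihedral (- 1) (int s)))"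
    unfolding walsh_series_def card_automorphisms sum_automorphisms by (simp add: distrib_left)
  show ?thesis
  proof (intro conjI impI)
    assume "odd n"
    then obtain m where m: "n = 2 * m + 1" by (elim oddE)
    have idx: "(n - 1) div 2 = m" "(n - 3) div 2 = m - 1" using m by auto
    \<comment> \<open>All \<open>n\<close> reflections contribute equally, which leaves
      \<open>n / (2 * n) = 1 / 2\<close>.\<close>
    have "(1::'a) / (2 * of_nat n) * (of_nat n * x) = 1 / 2 * x" for x using n_pos by simp
    then show "walsh_series (cycle_graph n) a b c \<beta> \<gamma> = 1 / (2 * of_nat n) * ?R
         + 1 / 2 * a 1 * a 2 ^ ((n - 1) div 2) *
           (\<beta> 2 * \<gamma> 1 * path_U ((n - 1) div 2) (b 2) (\<beta> 2)
            + \<beta> 2 ^ 2 * c 1 * path_U ((n - 3) div 2) (b 2) (\<beta> 2))"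
      unfolding series sum_reflection_odd[OF m] idx sum_constant card_greaterThanAtMost diff_zero
      by (simp only: mult.assoc)
  next
    assume "even n"
    then obtain m where m: "n = 2 * m" by (elim evenE)
    have idx: "(n - 2) div 2 = m - 1" "(n - 4) div 2 = m - 2" "n div 2 = m" using m by auto
    \<comment> \<open>There are \<open>m = n / 2\<close> reflections of each type, which leaves
      \<open>m / (2 * n) = 1 / 4\<close>.\<close>
    have "(1::'a) / (2 * of_nat n) * (of_nat m * x) = 1 / 4 * x" for x using m n_pos by simp
    then show "walsh_series (cycle_graph n) a b c \<beta> \<gamma> = 1 / (2 * of_nat n) * ?R
         + 1 / 4 *
           (a 1 ^ 2 * a 2 ^ ((n - 2) div 2) * \<beta> 2 ^ 2 * path_U ((n - 2) div 2) (b 2) (\<beta> 2)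
            + a 2 ^ (n div 2) *
              (\<gamma> 1 ^ 2 * path_U (n div 2) (b 2) (\<beta> 2)
               + 2 * c 1 * \<gamma> 1 * \<beta> 2 * path_U ((n - 2) div 2) (b 2) (\<beta> 2)
               + c 1 ^ 2 * \<beta> 2 ^ 2 * path_U ((n - 4) div 2) (b 2) (\<beta> 2)))"
      unfolding series sum_reflection_even[OF m] idx even_of_nat_iff
      unfolding m sum_if_even
      by (simp only:)
  qed
qed

end
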